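(* Suppose that for every $n\in\mathbb N$ we have a system of random variables $X^n:=\{X^n_v:v\in V_n\}$ with $\mathbb E[(X^n_v)^2]<\infty$ on a common probability space $(\Omega^{V_n},\mathbb P_n)$, with $V_n$ finite and $\lim_{n\to\infty}|V_n|=\infty$. In the cases of sparse reconstruction (SR) below, assume further that for every $n$ the joint distribution of $X^n$ is $\Gamma_n$-invariant, where the group $\Gamma_n$ acts transitively on $V_n$. If there is RSR (respectively non-degenerate RSR, SR, non-degenerate SR) for $\{X^n\}_{n\in\mathbb N}$, then there is also full RSR (respectively full non-degenerate RSR, full SR, full non-degenerate SR) for $\{X^n\}_{n\in\mathbb N}$.
   Context: For $U\subseteq V_n$ let $\mathcal F_U$ be the $\sigma$-algebra generated by $\{X^n_v:v\in U\}$. For a square-integrable function $f$ of $X^n$, $\mathsf{clue}(f\,|\,U):=\mathrm{Var}(\mathbb E[f\,|\,\mathcal F_U])/\mathrm{Var}(f)$ (and $0$ if $\mathrm{Var}(f)=0$). For a random $\mathcal U\subseteq V_n$ independent of $X^n$, its revealment is $\delta(\mathcal U)=\max_{j\in V_n}\mathbb P[j\in\mathcal U]$. RSR (random sparse reconstruction) for $\{X^n\}$: there exist square-integrable real functions $f_n$ of $X^n$, random subsets $\mathcal U_n\subseteq V_n$ independent of $X^n$ with $\delta(\mathcal U_n)\to0$, and $c>0$ with $\mathbb E[\mathsf{clue}(f_n\,|\,\mathcal U_n)]>c$ for all $n$. It is full RSR if one can have $\lim_n\mathbb E[\mathsf{clue}(f_n\,|\,\mathcal U_n)]=1$. SR (sparse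 reconstruction) for $\{X^n\}$: there exist $\Gamma_n$-invariant square-integrable real functions $f_n$ of $X^n$ and deterministic subsets $U_n\subseteq V_n$ with $|U_n|/|V_n|\to0$ and $\liminf_n\mathsf{clue}(f_n\,|\,U_n)>0$. It is full SR if one can have $\lim_n\mathsf{clue}(f_n\,|\,U_n)=1$. The non-degenerate versions (partial and full) require in addition that the functions $f_n$ be Boolean ($\{-1,1\}$-valued) and that $\mathrm{Var}(f_n)$ be bounded away from $0$. *)

theory Defs
  imports "HOL-Probability.Probability" "HOL-Algebra.Group_Action"
begin

definition config :: "'v set \<Rightarrow> ('v \<Rightarrow> 's \<Rightarrow> real) \<Rightarrow> 's \<Rightarrow> 'v \<Rightarrow> real" where
  "config V X \<omega> = (\<lambda>v\<in>V. X v \<omega>)"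

definition config_space :: "'v set \<Rightarrow> ('v \<Rightarrow> real) measure" where
  "config_space V = PiM V (\<lambda>_. borel)"

(* Only the space and the sets of this measure matter. Generating by the union of the
   preimages (not by the supremum of the individual algebras, whose space would be empty
   for U = {}) gives the trivial algebra for U = {}. *)
definition gen_alg :: "'s measure \<Rightarrow> ('v \<Rightarrow> 's \<Rightarrow> real) \<Rightarrow> 'v set \<Rightarrow> 's measure" where
  "gen_alg M X U =
     sigma (space M) {X v -` A \<inter> space M | v A. v \<in> U \<and> A \<in> sets borel}"

definition clue :: "'s measure \<Rightarrow> ('v \<Rightarrow> 's \<Rightarrow> real) \<Rightarrow> ('s \<Rightarrow> real) \<Rightarrow> 'v set \<Rightarrow> real" where
  "clue M X f U =
     (if prob_space.variance M f = 0 then 0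
      else prob_space.variance M (real_cond_exp M (gen_alg M X U) f) / prob_space.variance M f)"

(* F is a function on the configuration space; the random variable it stands for is
   F o config V X. *)
definition square_integrable_fun ::
  "'s measure \<Rightarrow> 'v set \<Rightarrow> ('v \<Rightarrow> 's \<Rightarrow> real) \<Rightarrow> (('v \<Rightarrow> real) \<Rightarrow> real) \<Rightarrow> bool" where
  "square_integrable_fun M V X F \<longleftrightarrow>
     F \<in> borel_measurable (config_space V) \<and>
     integrable M (\<lambda>\<omega>. (F (config V X \<omega>))\<^sup>2)"

(* A random subset of V independent of X is given by its law, a pmf supported on Pow V,
   the joint law with X being the product. So the clue given a realisation U is computed
   under the unconditioned law of X, and expectations of it are taken over the pmf. *)
definition revealment :: "'v set \<Rightarrow> 'v set pmf \<Rightarrow> real" where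
  "revealment V \<U> = Max ((\<lambda>j. measure_pmf.prob \<U> {U. j \<in> U}) ` V)"

definition expected_clue ::
  "'s measure \<Rightarrow> ('v \<Rightarrow> 's \<Rightarrow> real) \<Rightarrow> ('s \<Rightarrow> real) \<Rightarrow> 'v set pmf \<Rightarrow> real" where
  "expected_clue M X f \<U> = measure_pmf.expectation \<U> (\<lambda>U. clue M X f U)"

definition nondegenerate ::
  "(nat \<Rightarrow> 's measure) \<Rightarrow> (nat \<Rightarrow> 'v set) \<Rightarrow> (nat \<Rightarrow> 'v \<Rightarrow> 's \<Rightarrow> real) \<Rightarrow>
   (nat \<Rightarrow> ('v \<Rightarrow> real) \<Rightarrow> real) \<Rightarrow> bool" where
  "nondegenerate P V X F \<longleftrightarrow>
     (\<forall>n. \<forall>x\<in>space (config_space (V n)). F n x \<in> {-1, 1}) \<and>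
     (\<exists>\<epsilon>>0. \<forall>n. \<epsilon> \<le> prob_space.variance (P n) (F n \<circ> config (V n) (X n)))"


definition RSR_by ::
  "(nat \<Rightarrow> 's measure) \<Rightarrow> (nat \<Rightarrow> 'v set) \<Rightarrow> (nat \<Rightarrow> 'v \<Rightarrow> 's \<Rightarrow> real) \<Rightarrow>
   (nat \<Rightarrow> ('v \<Rightarrow> real) \<Rightarrow> real) \<Rightarrow> (nat \<Rightarrow> 'v set pmf) \<Rightarrow> bool" where
  "RSR_by P V X F \<U> \<longleftrightarrow>
     (\<forall>n. square_integrable_fun (P n) (V n) (X n) (F n)) \<and>
     (\<forall>n. set_pmf (\<U> n) \<subseteq> Pow (V n)) \<and>
     (\<lambda>n. revealment (V n) (\<U> n)) \<longlonglongrightarrow> 0 \<and>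
     (\<exists>c>0. \<forall>n. expected_clue (P n) (X n) (F n \<circ> config (V n) (X n)) (\<U> n) > c)"

definition full_RSR_by ::
  "(nat \<Rightarrow> 's measure) \<Rightarrow> (nat \<Rightarrow> 'v set) \<Rightarrow> (nat \<Rightarrow> 'v \<Rightarrow> 's \<Rightarrow> real) \<Rightarrow>
   (nat \<Rightarrow> ('v \<Rightarrow> real) \<Rightarrow> real) \<Rightarrow> (nat \<Rightarrow> 'v set pmf) \<Rightarrow> bool" where
  "full_RSR_by P V X F \<U> \<longleftrightarrow>
     RSR_by P V X F \<U> \<and>
     (\<lambda>n. expected_clue (P n) (X n) (F n \<circ> config (V n) (X n)) (\<U> n)) \<longlonglongrightarrow> 1"

definition RSR ::
  "(nat \<Rightarrow> 's measure) \<Rightarrow> (nat \<Rightarrow> 'v set) \<Rightarrow> (nat \<Rightarrow> 'v \<Rightarrow> 's \<Rightarrow> real) \<Rightarrow> bool" where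
  "RSR P V X \<longleftrightarrow> (\<exists>F \<U>. RSR_by P V X F \<U>)"

definition full_RSR ::
  "(nat \<Rightarrow> 's measure) \<Rightarrow> (nat \<Rightarrow> 'v set) \<Rightarrow> (nat \<Rightarrow> 'v \<Rightarrow> 's \<Rightarrow> real) \<Rightarrow> bool" where
  "full_RSR P V X \<longleftrightarrow> (\<exists>F \<U>. full_RSR_by P V X F \<U>)"

definition nondegenerate_RSR ::
  "(nat \<Rightarrow> 's measure) \<Rightarrow> (nat \<Rightarrow> 'v set) \<Rightarrow> (nat \<Rightarrow> 'v \<Rightarrow> 's \<Rightarrow> real) \<Rightarrow> bool" where
  "nondegenerate_RSR P V X \<longleftrightarrow> (\<exists>F \<U>. RSR_by P V X F \<U> \<and> nondegenerate P V X F)"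

definition full_nondegenerate_RSR ::
  "(nat \<Rightarrow> 's measure) \<Rightarrow> (nat \<Rightarrow> 'v set) \<Rightarrow> (nat \<Rightarrow> 'v \<Rightarrow> 's \<Rightarrow> real) \<Rightarrow> bool" where
  "full_nondegenerate_RSR P V X \<longleftrightarrow>
     (\<exists>F \<U>. full_RSR_by P V X F \<U> \<and> nondegenerate P V X F)"


(* The group G acts on V through \<phi>, and g acts on configurations by x |-> (x (\<phi> g v))_v.
   This is the action of the inverse of g in the usual convention, which does not
   matter below since all g are quantified over. *)
definition translate :: "'v set \<Rightarrow> ('v \<Rightarrow> 'v) \<Rightarrow> ('v \<Rightarrow> real) \<Rightarrow> 'v \<Rightarrow> real" where
  "translate V \<pi> x = (\<lambda>v\<in>V. x (\<pi> v))"

definition invariant_law ::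
  "'g monoid \<Rightarrow> ('g \<Rightarrow> 'v \<Rightarrow> 'v) \<Rightarrow> 's measure \<Rightarrow> 'v set \<Rightarrow> ('v \<Rightarrow> 's \<Rightarrow> real) \<Rightarrow> bool" where
  "invariant_law G \<phi> M V X \<longleftrightarrow>
     (\<forall>g\<in>carrier G.
        distr M (config_space V) (translate V (\<phi> g) \<circ> config V X)
      = distr M (config_space V) (config V X))"

definition invariant_fun ::
  "'g monoid \<Rightarrow> ('g \<Rightarrow> 'v \<Rightarrow> 'v) \<Rightarrow> 'v set \<Rightarrow> (('v \<Rightarrow> real) \<Rightarrow> real) \<Rightarrow> bool" where
  "invariant_fun G \<phi> V F \<longleftrightarrow>
     (\<forall>g\<in>carrier G. \<forall>x\<in>space (config_space V). F (translate V (\<phi> g) x) = F x)"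

definition SR_by ::
  "(nat \<Rightarrow> 'g monoid) \<Rightarrow> (nat \<Rightarrow> 'g \<Rightarrow> 'v \<Rightarrow> 'v) \<Rightarrow>
   (nat \<Rightarrow> 's measure) \<Rightarrow> (nat \<Rightarrow> 'v set) \<Rightarrow> (nat \<Rightarrow> 'v \<Rightarrow> 's \<Rightarrow> real) \<Rightarrow>
   (nat \<Rightarrow> ('v \<Rightarrow> real) \<Rightarrow> real) \<Rightarrow> (nat \<Rightarrow> 'v set) \<Rightarrow> bool" where
  "SR_by G \<phi> P V X F U \<longleftrightarrow>
     (\<forall>n. square_integrable_fun (P n) (V n) (X n) (F n)) \<and>
     (\<forall>n. invariant_fun (G n) (\<phi> n) (V n) (F n)) \<and>
     (\<forall>n. U n \<subseteq> V n) \<and>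
     (\<lambda>n. real (card (U n)) / real (card (V n))) \<longlonglongrightarrow> 0 \<and>
     liminf (\<lambda>n. ereal (clue (P n) (X n) (F n \<circ> config (V n) (X n)) (U n))) > 0"

definition full_SR_by ::
  "(nat \<Rightarrow> 'g monoid) \<Rightarrow> (nat \<Rightarrow> 'g \<Rightarrow> 'v \<Rightarrow> 'v) \<Rightarrow>
   (nat \<Rightarrow> 's measure) \<Rightarrow> (nat \<Rightarrow> 'v set) \<Rightarrow> (nat \<Rightarrow> 'v \<Rightarrow> 's \<Rightarrow> real) \<Rightarrow>
   (nat \<Rightarrow> ('v \<Rightarrow> real) \<Rightarrow> real) \<Rightarrow> (nat \<Rightarrow> 'v set) \<Rightarrow> bool" where
  "full_SR_by G \<phi> P V X F U \<longleftrightarrow>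
     SR_by G \<phi> P V X F U \<and>
     (\<lambda>n. clue (P n) (X n) (F n \<circ> config (V n) (X n)) (U n)) \<longlonglongrightarrow> 1"

definition SR ::
  "(nat \<Rightarrow> 'g monoid) \<Rightarrow> (nat \<Rightarrow> 'g \<Rightarrow> 'v \<Rightarrow> 'v) \<Rightarrow>
   (nat \<Rightarrow> 's measure) \<Rightarrow> (nat \<Rightarrow> 'v set) \<Rightarrow> (nat \<Rightarrow> 'v \<Rightarrow> 's \<Rightarrow> real) \<Rightarrow> bool" where
  "SR G \<phi> P V X \<longleftrightarrow> (\<exists>F U. SR_by G \<phi> P V X F U)"

definition full_SR ::
  "(nat \<Rightarrow> 'g monoid) \<Rightarrow> (nat \<Rightarrow> 'g \<Rightarrow> 'v \<Rightarrow> 'v) \<Rightarrow>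
   (nat \<Rightarrow> 's measure) \<Rightarrow> (nat \<Rightarrow> 'v set) \<Rightarrow> (nat \<Rightarrow> 'v \<Rightarrow> 's \<Rightarrow> real) \<Rightarrow> bool" where
  "full_SR G \<phi> P V X \<longleftrightarrow> (\<exists>F U. full_SR_by G \<phi> P V X F U)"

definition nondegenerate_SR ::
  "(nat \<Rightarrow> 'g monoid) \<Rightarrow> (nat \<Rightarrow> 'g \<Rightarrow> 'v \<Rightarrow> 'v) \<Rightarrow>
   (nat \<Rightarrow> 's measure) \<Rightarrow> (nat \<Rightarrow> 'v set) \<Rightarrow> (nat \<Rightarrow> 'v \<Rightarrow> 's \<Rightarrow> real) \<Rightarrow> bool" where
  "nondegenerate_SR G \<phi> P V X \<longleftrightarrow>
     (\<exists>F U. SR_by G \<phi> P V X F U \<and> nondegenerate P V X F)"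

definition full_nondegenerate_SR ::
  "(nat \<Rightarrow> 'g monoid) \<Rightarrow> (nat \<Rightarrow> 'g \<Rightarrow> 'v \<Rightarrow> 'v) \<Rightarrow>
   (nat \<Rightarrow> 's measure) \<Rightarrow> (nat \<Rightarrow> 'v set) \<Rightarrow> (nat \<Rightarrow> 'v \<Rightarrow> 's \<Rightarrow> real) \<Rightarrow> bool" where
  "full_nondegenerate_SR G \<phi> P V X \<longleftrightarrow>
     (\<exists>F U. full_SR_by G \<phi> P V X F U \<and> nondegenerate P V X F)"

end

theory Submission
  imports Defs
begin

text \<open>
  Let U be random and T f = E_U (E (f | F_U)). If the expected clue of f is at least c then, by
  Cauchy-Schwarz, Var (T f) \<ge> c^2 Var f. Let U_1, ..., U_k be independent copies of U. The mean
  of the E (f | F_{U_i}) is measurable with respect to the union of the U_i, and by the variance of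
  a sample mean its squared L^2 distance from T f averages at most Var f / k. Hence T f has clue
  close to 1 with respect to the union, whose revealment is at most k times that of U, and k can
  tend to infinity so slowly that this still vanishes.

  For sparse reconstruction the same argument applies to the translates of the given set by the
  finitely many permutations through which the group acts. Averaging over them makes T f
  invariant, and some realisation of the union does at least as well as the average one. For
  Boolean f one replaces T f by a threshold of T f at a level that is chosen by averaging.
\<close>

subsection \<open>Sample means\<close>

text \<open>Cauchy-Schwarz is applicable because Cov (f, T f) is the mean over U of Var (E (f |
  F_U)), each conditional expectation being an orthogonal projection of f. For Boolean f two demands
  compete for one level: the threshold of T f must keep a definite variance, and T f and the sample
  mean must rarely lie on different sides of it. A level that is good for one may be bad for the
  other, so both are put into one inequality, in which the disagreement is weighted against the
  variance. With e = k^(-1/4), T f and the sample mean are on average within e^2 in L^1; the weight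
  1/e then costs 2 e of variance and leaves a disagreement of order e. Invariance is an identity
  between functions of the configuration, valid everywhere, whereas conditional expectations live on
  the sample space and are fixed only up to null sets. They are therefore represented by functions h
  of the configuration, and averaging the translates of h gives exact invariance.\<close>

lemma expectation_finite_pmf:
  fixes f :: "'i \<Rightarrow> real"
  assumes "finite (set_pmf q)"
  shows "measure_pmf.expectation q f = (\<Sum>i\<in>set_pmf q. pmf q i * f i)"
  by (subst integral_measure_pmf[OF assms]) auto

lemma finite_set_replicate_pmf:
  "finite (set_pmf q) \<Longrightarrow> finite (set_pmf (replicate_pmf k q))"
  unfolding set_replicate_pmf by (simp add: finite_lists_length_eq lists_eq_set)

lemma expectation_replicate_pmf_Suc:
  fixes f :: "'i list \<Rightarrow> real"
  assumes "finite (set_pmf q)"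
  shows "measure_pmf.expectation (replicate_pmf (Suc k) q) f =
    measure_pmf.expectation q (\<lambda>i. measure_pmf.expectation (replicate_pmf k q) (\<lambda>l. f (i # l)))"
proof -
  have "measure_pmf.expectation (replicate_pmf (Suc k) q) f =
     (\<Sum>i\<in>set_pmf q. pmf q i * measure_pmf.expectation (map_pmf (Cons i) (replicate_pmf k q)) f)"
    using pmf_expectation_bind[OF assms, of "\<lambda>i. map_pmf (Cons i) (replicate_pmf k q)" q f]
    by (simp add: map_pmf_def finite_set_replicate_pmf[OF assms])
  then show ?thesis by (simp add: expectation_finite_pmf[OF assms])
qed

text \<open>The cross terms vanish: when the square is expanded around the first sample,
  \<open>a i\<close> is multiplied by a quantity independent of i, and \<open>a\<close> has mean
  zero.\<close>

lemma expectation_square_sum_list_replicate_pmf: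
  fixes a :: "'i \<Rightarrow> real"
  assumes fin: "finite (set_pmf q)" and zero: "measure_pmf.expectation q a = 0"
  shows "measure_pmf.expectation (replicate_pmf k q) (\<lambda>l. (\<Sum>i\<leftarrow>l. a i)\<^sup>2) =
    real k * measure_pmf.expectation q (\<lambda>i. (a i)\<^sup>2)"
proof (induction k)
  case (Suc k)
  let ?S = "\<lambda>l. \<Sum>i\<leftarrow>l. a i"
  note int = integrable_measure_pmf_finite[OF fin]
    integrable_measure_pmf_finite[OF finite_set_replicate_pmf[OF fin]]
  have "measure_pmf.expectation (replicate_pmf (Suc k) q) (\<lambda>l. (?S l)\<^sup>2) =
    measure_pmf.expectation q (\<lambda>i. measure_pmf.expectation (replicate_pmf k q)
      (\<lambda>l. (a i)\<^sup>2 + a i * (2 * ?S l) + (?S l)\<^sup>2))"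
    unfolding expectation_replicate_pmf_Suc[OF fin] by (simp add: power2_eq_square algebra_simps)
  also have "\<dots> = measure_pmf.expectation q (\<lambda>i. (a i)\<^sup>2
      + a i * measure_pmf.expectation (replicate_pmf k q) (\<lambda>l. 2 * ?S l)
      + measure_pmf.expectation (replicate_pmf k q) (\<lambda>l. (?S l)\<^sup>2))"
    by (simp add: int)
  also have "\<dots> = measure_pmf.expectation q (\<lambda>i. (a i)\<^sup>2)
      + measure_pmf.expectation (replicate_pmf k q) (\<lambda>l. (?S l)\<^sup>2)"
    using int(1)[of "\<lambda>i. (a i)\<^sup>2"] int(1)[of a] by (simp add: zero)
  finally show ?case by (simp add: Suc algebra_simps)
qed simp

text \<open>Centring reduces the claim to the sum of k independent mean-zero terms. It will be used
  with a fixed point x of the probability space and \<open>y i = Y i x\<close>, so the randomness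
  here is that of the sampled sets only.\<close>

lemma expectation_sample_mean_replicate_pmf:
  fixes y :: "'i \<Rightarrow> real"
  assumes fin: "finite (set_pmf q)" and k: "k > 0"
  defines "m \<equiv> measure_pmf.expectation q y"
  shows "measure_pmf.expectation (replicate_pmf k q) (\<lambda>l. (m - (\<Sum>i\<leftarrow>l. y i) / real k)\<^sup>2) =
    (measure_pmf.expectation q (\<lambda>i. (y i)\<^sup>2) - m\<^sup>2) / real k"
proof -
  note int = integrable_measure_pmf_finite[OF fin]
  have centred: "measure_pmf.expectation q (\<lambda>i. y i - m) = 0"
    by (simp add: int m_def)
  have "(m - (\<Sum>i\<leftarrow>l. y i) / real k)\<^sup>2 = (\<Sum>i\<leftarrow>l. y i - m)\<^sup>2 / (real k)\<^sup>2"
    if "l \<in> set_pmf (replicate_pmf k q)" for l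
  proof -
    have "(\<Sum>i\<leftarrow>l. y i - m) = (\<Sum>i\<leftarrow>l. y i) - real k * m"
      using that by (simp add: set_replicate_pmf sum_list_subtractf sum_list_triv)
    then show ?thesis using k
      by (simp add: power_divide[symmetric] diff_divide_distrib power2_commute)
  qed
  then have "measure_pmf.expectation (replicate_pmf k q) (\<lambda>l. (m - (\<Sum>i\<leftarrow>l. y i) / real k)\<^sup>2) =
    measure_pmf.expectation (replicate_pmf k q) (\<lambda>l. (\<Sum>i\<leftarrow>l. y i - m)\<^sup>2 / (real k)\<^sup>2)"
    by (intro integral_cong_AE) (auto simp: AE_measure_pmf_iff)
  also have "\<dots> = measure_pmf.expectation q (\<lambda>i. (y i - m)\<^sup>2) / real k"
    using k expectation_square_sum_list_replicate_pmf[OF fin centred, of k]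
    by (simp add: power2_eq_square[of "real k"])
  also have "measure_pmf.expectation q (\<lambda>i. (y i - m)\<^sup>2) =
    measure_pmf.expectation q (\<lambda>i. (y i)\<^sup>2) - m\<^sup>2"
    unfolding m_def by (rule measure_pmf.variance_eq[OF int int])
  finally show ?thesis .
qed

section \<open>Conditional expectation as orthogonal projection, and averages of projections\<close>

context prob_space
begin

lemma integrable_mult_of_square_integrable:
  fixes f g :: "'a \<Rightarrow> real"
  assumes [measurable]: "f \<in> borel_measurable M" "g \<in> borel_measurable M"
    and "integrable M (\<lambda>x. (f x)\<^sup>2)" "integrable M (\<lambda>x. (g x)\<^sup>2)"
  shows "integrable M (\<lambda>x. f x * g x)"
proof (rule Bochner_Integration.integrable_bound)
  show "integrable M (\<lambda>x. (f x)\<^sup>2 + (g x)\<^sup>2)" using assms by simp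
  have "\<bar>u * v\<bar> \<le> u\<^sup>2 + v\<^sup>2" for u v :: real
    using sum_squares_bound[of "\<bar>u\<bar>" "\<bar>v\<bar>"] mult_nonneg_nonneg[of "\<bar>u\<bar>" "\<bar>v\<bar>"]
    unfolding abs_mult power2_abs by linarith
  then show "AE x in M. norm (f x * g x) \<le> norm ((f x)\<^sup>2 + (g x)\<^sup>2)" by simp
qed simp

lemma expectation_square_diff:
  fixes f g :: "'a \<Rightarrow> real"
  assumes [measurable]: "f \<in> borel_measurable M" "g \<in> borel_measurable M"
    and "integrable M (\<lambda>x. (f x)\<^sup>2)" "integrable M (\<lambda>x. (g x)\<^sup>2)"
  shows "integrable M (\<lambda>x. (f x - g x)\<^sup>2)"
    and "expectation (\<lambda>x. (f x - g x)\<^sup>2) =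
      expectation (\<lambda>x. (f x)\<^sup>2) - 2 * expectation (\<lambda>x. f x * g x) + expectation (\<lambda>x. (g x)\<^sup>2)"
  using integrable_mult_of_square_integrable[OF assms] assms
  by (simp_all add: power2_diff mult.assoc)

text \<open>Conditional Jensen for the square gives square integrability, which makes the
  conditional expectation itself an admissible test function g. That choice of g yields the last
  identity, the inner product of f with its own projection.\<close>

lemma
  fixes f g :: "'a \<Rightarrow> real"
  assumes F: "subalgebra M F"
    and [measurable]: "f \<in> borel_measurable M" and f2: "integrable M (\<lambda>x. (f x)\<^sup>2)"
  shows square_integrable_real_cond_exp: "integrable M (\<lambda>x. (real_cond_exp M F f x)\<^sup>2)"
    and expectation_mult_real_cond_exp:
      "g \<in> borel_measurable F \<Longrightarrow> integrable M (\<lambda>x. (g x)\<^sup>2) \<Longrightarrow>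
       expectation (\<lambda>x. g x * real_cond_exp M F f x) = expectation (\<lambda>x. g x * f x)"
    and expectation_square_real_cond_exp:
      "expectation (\<lambda>x. f x * real_cond_exp M F f x) = expectation (\<lambda>x. (real_cond_exp M F f x)\<^sup>2)"
proof -
  interpret S: finite_measure_subalgebra M F by standard (rule F)
  have f1: "integrable M f" by (rule square_integrable_imp_integrable[OF _ f2]) simp
  have "convex_on UNIV (\<lambda>x::real. x\<^sup>2)" by (rule convex_power_even) simp
  then show p2: "integrable M (\<lambda>x. (real_cond_exp M F f x)\<^sup>2)"
    by (intro S.integrable_convex_cond_exp[where X = f and I = UNIV and q = "\<lambda>x. x\<^sup>2"]) (auto simp: f1 f2)
  have *: "expectation (\<lambda>x. g x * real_cond_exp M F f x) = expectation (\<lambda>x. g x * f x)"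
    if g: "g \<in> borel_measurable F" "integrable M (\<lambda>x. (g x)\<^sup>2)" for g
    using g f2 measurable_from_subalg[OF F g(1)]
    by (intro S.real_cond_exp_intg(2) integrable_mult_of_square_integrable) auto
  then show "g \<in> borel_measurable F \<Longrightarrow> integrable M (\<lambda>x. (g x)\<^sup>2) \<Longrightarrow>
       expectation (\<lambda>x. g x * real_cond_exp M F f x) = expectation (\<lambda>x. g x * f x)" .
  show "expectation (\<lambda>x. f x * real_cond_exp M F f x) = expectation (\<lambda>x. (real_cond_exp M F f x)\<^sup>2)"
    using *[OF borel_measurable_cond_exp p2] by (simp add: power2_eq_square mult.commute)
qed

lemma variance_real_cond_exp:
  assumes F: "subalgebra M F"
    and [measurable]: "f \<in> borel_measurable M" and f2: "integrable M (\<lambda>x. (f x)\<^sup>2)"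
  shows "variance (real_cond_exp M F f) =
    expectation (\<lambda>x. (real_cond_exp M F f x)\<^sup>2) - (expectation f)\<^sup>2"
proof -
  interpret S: finite_measure_subalgebra M F by standard (rule F)
  have f1: "integrable M f" by (rule square_integrable_imp_integrable[OF _ f2]) simp
  show ?thesis
    using S.real_cond_exp_int[OF f1] square_integrable_real_cond_exp[OF assms]
    by (subst variance_eq) simp_all
qed

text \<open>Pythagoras: the variance lost by projecting f is its squared distance from the
  F-measurable functions, hence at most the squared distance from any particular g. The proof
  expands the squared distance between g and the projection.\<close>

lemma variance_diff_le_variance_real_cond_exp:
  assumes F: "subalgebra M F"
    and [measurable]: "f \<in> borel_measurable M" and f2: "integrable M (\<lambda>x. (f x)\<^sup>2)"
    and g: "g \<in> borel_measurable F" "integrable M (\<lambda>x. (g x)\<^sup>2)"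
  shows "variance f - expectation (\<lambda>x. (f x - g x)\<^sup>2) \<le> variance (real_cond_exp M F f)"
proof -
  have f1: "integrable M f" by (rule square_integrable_imp_integrable[OF _ f2]) simp
  have [measurable]: "g \<in> borel_measurable M" by (rule measurable_from_subalg[OF F g(1)])
  note p2 = square_integrable_real_cond_exp[OF F _ f2]
  have "0 \<le> expectation (\<lambda>x. (real_cond_exp M F f x - g x)\<^sup>2)" by simp
  also have "\<dots> = expectation (\<lambda>x. (real_cond_exp M F f x)\<^sup>2)
      - 2 * expectation (\<lambda>x. g x * f x) + expectation (\<lambda>x. (g x)\<^sup>2)"
    using expectation_mult_real_cond_exp[OF F _ f2 g] p2 g
    by (subst expectation_square_diff(2)) (auto simp: mult.commute borel_measurable_cond_exp2)
  finally show ?thesis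
    using expectation_square_diff(2)[OF _ _ f2 g(2)] variance_real_cond_exp[OF F _ f2] f1 f2
    by (simp add: variance_eq mult.commute)
qed

lemma variance_real_cond_exp_le:
  assumes F: "subalgebra M F"
    and [measurable]: "f \<in> borel_measurable M" and f2: "integrable M (\<lambda>x. (f x)\<^sup>2)"
  shows "variance (real_cond_exp M F f) \<le> variance f"
proof -
  have f1: "integrable M f" by (rule square_integrable_imp_integrable[OF _ f2]) simp
  note p2 = square_integrable_real_cond_exp[OF assms]
  have "0 \<le> expectation (\<lambda>x. (f x - real_cond_exp M F f x)\<^sup>2)" by simp
  also have "\<dots> = expectation (\<lambda>x. (f x)\<^sup>2) - expectation (\<lambda>x. (real_cond_exp M F f x)\<^sup>2)"
    using expectation_square_diff(2)[OF _ _ f2 p2] expectation_square_real_cond_exp[OF assms]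
    by (simp add: borel_measurable_cond_exp2)
  finally show ?thesis using variance_real_cond_exp[OF assms] f1 f2 by (simp add: variance_eq)
qed

text \<open>No sigma-algebra is mentioned: what is kept of E (f | F) is its mean and the identity
  between its inner product with f and its squared norm. Both survive passing to an almost
  everywhere equal version, and passing to a translate when f and the law are invariant.\<close>

definition L2_projection_of :: "('a \<Rightarrow> real) \<Rightarrow> ('a \<Rightarrow> real) \<Rightarrow> bool" where
  "L2_projection_of f Y \<longleftrightarrow> Y \<in> borel_measurable M \<and> integrable M (\<lambda>x. (Y x)\<^sup>2) \<and>
    expectation Y = expectation f \<and> expectation (\<lambda>x. f x * Y x) = expectation (\<lambda>x. (Y x)\<^sup>2)"

text \<open>All \<open>Y i\<close> share the mean of f, and pairing with f shows that Cov (f, Z) is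
  the average of Var (Y i). The lower bound on Var Z is Cauchy-Schwarz in the form Var (Z - c f)
  \<ge> 0, that is, Var Z \<ge> 2 c Cov (f, Z) - c^2 Var f. For the distance, the two expectations
  are exchanged and the formula for sample means is applied at each point; what remains is the
  average of Var (Y i) minus Var Z, divided by k, and no Var (Y i) exceeds Var f.\<close>

lemma L2_projection_average:
  fixes Y :: "'i \<Rightarrow> 'a \<Rightarrow> real"
  assumes f [measurable]: "f \<in> borel_measurable M" and f2: "integrable M (\<lambda>x. (f x)\<^sup>2)"
    and fin: "finite (set_pmf q)"
    and Y: "\<And>i. i \<in> set_pmf q \<Longrightarrow> L2_projection_of f (Y i)"
  defines "Z \<equiv> \<lambda>x. measure_pmf.expectation q (\<lambda>i. Y i x)"
  shows "Z \<in> borel_measurable M" "integrable M (\<lambda>x. (Z x)\<^sup>2)"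
    and "0 \<le> c \<Longrightarrow> c * variance f \<le> measure_pmf.expectation q (\<lambda>i. variance (Y i)) \<Longrightarrow>
      c\<^sup>2 * variance f \<le> variance Z"
    and "k > 0 \<Longrightarrow> measure_pmf.expectation (replicate_pmf k q)
      (\<lambda>l. expectation (\<lambda>x. (Z x - (\<Sum>i\<leftarrow>l. Y i x) / real k)\<^sup>2)) \<le> variance f / real k"
proof -
  note sum_pmf = expectation_finite_pmf[OF fin]
  have Z: "Z x = (\<Sum>i\<in>set_pmf q. pmf q i * Y i x)" for x
    unfolding Z_def by (rule sum_pmf)
  have Ym [measurable]: "Y i \<in> borel_measurable M" and Y2: "integrable M (\<lambda>x. (Y i x)\<^sup>2)"
    and EY: "expectation (Y i) = expectation f"
    and EfY: "expectation (\<lambda>x. f x * Y i x) = expectation (\<lambda>x. (Y i x)\<^sup>2)"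
    if "i \<in> set_pmf q" for i
    using Y[OF that] by (auto simp: L2_projection_of_def)
  have f1: "integrable M f" by (rule square_integrable_imp_integrable[OF f f2])
  have Y1: "integrable M (Y i)" if "i \<in> set_pmf q" for i
    by (rule square_integrable_imp_integrable[OF Ym[OF that] Y2[OF that]])
  show Zm [measurable]: "Z \<in> borel_measurable M"
    unfolding Z[abs_def] by measurable
  have ZZ: "(Z x)\<^sup>2 = (\<Sum>i\<in>set_pmf q. \<Sum>j\<in>set_pmf q. pmf q i * pmf q j * (Y i x * Y j x))" for x
    unfolding Z power2_eq_square sum_product by (simp add: ac_simps)
  show Z2: "integrable M (\<lambda>x. (Z x)\<^sup>2)"
    unfolding ZZ using integrable_mult_of_square_integrable Ym Y2
    by (intro Bochner_Integration.integrable_sum integrable_mult_right) auto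
  have Z1: "integrable M Z" by (rule square_integrable_imp_integrable[OF Zm Z2])
  have sum1: "(\<Sum>i\<in>set_pmf q. pmf q i) = 1" by (rule sum_pmf_eq_1[OF fin order_refl])
  have EZ: "expectation Z = expectation f"
    unfolding Z[abs_def] by (simp add: Y1 EY sum1 flip: sum_distrib_right)
  let ?s = "measure_pmf.expectation q (\<lambda>i. expectation (\<lambda>x. (Y i x)\<^sup>2))"
  have EfZ: "expectation (\<lambda>x. f x * Z x) = ?s"
  proof -
    have "f x * Z x = (\<Sum>i\<in>set_pmf q. pmf q i * (f x * Y i x))" for x
      unfolding Z by (simp add: sum_distrib_left ac_simps)
    then show ?thesis unfolding sum_pmf
      by (simp add: integrable_mult_of_square_integrable[OF f Ym f2 Y2] EfY)
  qed
  have VY: "variance (Y i) = expectation (\<lambda>x. (Y i x)\<^sup>2) - (expectation f)\<^sup>2" if "i \<in> set_pmf q" for i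
    using variance_eq[OF Y1[OF that] Y2[OF that]] unfolding EY[OF that] .
  have EVY: "measure_pmf.expectation q (\<lambda>i. variance (Y i)) = ?s - (expectation f)\<^sup>2"
    unfolding sum_pmf
    by (simp add: VY right_diff_distrib sum_subtractf sum1 flip: sum_distrib_right)
  have VZ: "variance Z = expectation (\<lambda>x. (Z x)\<^sup>2) - (expectation f)\<^sup>2"
    using variance_eq[OF Z1 Z2] unfolding EZ .
  have Vf: "variance f = expectation (\<lambda>x. (f x)\<^sup>2) - (expectation f)\<^sup>2"
    by (rule variance_eq[OF f1 f2])
  show "c\<^sup>2 * variance f \<le> variance Z"
    if c: "0 \<le> c" "c * variance f \<le> measure_pmf.expectation q (\<lambda>i. variance (Y i))"
  proof -
    have cf2: "integrable M (\<lambda>x. (c * f x)\<^sup>2)" using f2 by (simp add: power_mult_distrib)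
    have "variance (\<lambda>x. Z x - c * f x) =
      expectation (\<lambda>x. (Z x - c * f x)\<^sup>2) - ((1 - c) * expectation f)\<^sup>2"
      using expectation_square_diff(1)[OF Zm _ Z2 cf2]
      by (subst variance_eq) (auto simp: Z1 f1 EZ left_diff_distrib)
    also have "expectation (\<lambda>x. (Z x - c * f x)\<^sup>2) =
      expectation (\<lambda>x. (Z x)\<^sup>2) - 2 * c * ?s + c\<^sup>2 * expectation (\<lambda>x. (f x)\<^sup>2)"
    proof -
      have "expectation (\<lambda>x. Z x * (c * f x)) = expectation (\<lambda>x. c * (f x * Z x))"
        by (simp add: ac_simps)
      then have "expectation (\<lambda>x. Z x * (c * f x)) = c * ?s" using EfZ by simp
      then show ?thesis using expectation_square_diff(2)[OF Zm _ Z2 cf2] by (simp add: power_mult_distrib)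
    qed
    finally have "0 \<le> variance Z - 2 * c * (?s - (expectation f)\<^sup>2) + c\<^sup>2 * variance f"
      using variance_positive[of "\<lambda>x. Z x - c * f x"]
      unfolding VZ Vf by (simp add: power2_eq_square algebra_simps)
    moreover have "c * (c * variance f) \<le> c * (?s - (expectation f)\<^sup>2)"
      using c unfolding EVY by (intro mult_left_mono)
    ultimately show ?thesis by (simp add: power2_eq_square algebra_simps)
  qed
  show "measure_pmf.expectation (replicate_pmf k q)
      (\<lambda>l. expectation (\<lambda>x. (Z x - (\<Sum>i\<leftarrow>l. Y i x) / real k)\<^sup>2)) \<le> variance f / real k"
    if k: "k > 0"
  proof -
    note finl = finite_set_replicate_pmf[OF fin, of k]
    have S: "(\<lambda>x. \<Sum>i\<leftarrow>l. Y i x) \<in> borel_measurable M \<and> integrable M (\<lambda>x. (\<Sum>i\<leftarrow>l. Y i x)\<^sup>2)"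
      if "set l \<subseteq> set_pmf q" for l using that
    proof (induction l)
      case (Cons i l)
      then have IH: "(\<lambda>x. \<Sum>i\<leftarrow>l. Y i x) \<in> borel_measurable M" "integrable M (\<lambda>x. (\<Sum>i\<leftarrow>l. Y i x)\<^sup>2)"
        and i: "i \<in> set_pmf q" by auto
      \<comment> \<open>The double minus writes the sum as a difference, so that square
        integrability of differences applies.\<close>
      have "integrable M (\<lambda>x. (Y i x - - (\<Sum>i\<leftarrow>l. Y i x))\<^sup>2)"
        using IH Ym[OF i] Y2[OF i] by (intro expectation_square_diff(1)) auto
      then show ?case using IH Ym[OF i] by simp
    qed simp
    have int: "integrable M (\<lambda>x. (Z x - (\<Sum>i\<leftarrow>l. Y i x) / real k)\<^sup>2)"
      if "l \<in> set_pmf (replicate_pmf k q)" for l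
    proof -
      have "set l \<subseteq> set_pmf q" using that by (auto simp: set_replicate_pmf)
      from S[OF this] show ?thesis
        using Z2 by (intro expectation_square_diff(1)) (auto simp: power_divide)
    qed
    have "measure_pmf.expectation (replicate_pmf k q)
      (\<lambda>l. expectation (\<lambda>x. (Z x - (\<Sum>i\<leftarrow>l. Y i x) / real k)\<^sup>2)) =
      expectation (\<lambda>x. measure_pmf.expectation (replicate_pmf k q)
        (\<lambda>l. (Z x - (\<Sum>i\<leftarrow>l. Y i x) / real k)\<^sup>2))"
      unfolding expectation_finite_pmf[OF finl] by (simp add: int)
    also have "\<dots> = expectation (\<lambda>x. (measure_pmf.expectation q (\<lambda>i. (Y i x)\<^sup>2) - (Z x)\<^sup>2) / real k)"
      unfolding Z_def by (simp add: expectation_sample_mean_replicate_pmf[OF fin k])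
    also have "\<dots> = (?s - expectation (\<lambda>x. (Z x)\<^sup>2)) / real k"
      unfolding sum_pmf by (simp add: Y2 Z2)
    also have "\<dots> \<le> variance f / real k"
    proof (intro divide_right_mono)
      have "variance (Y i) \<le> variance f" if i: "i \<in> set_pmf q" for i
      proof -
        \<comment> \<open>By the projection identity this expectation equals E f^2 - E (Y i)^2, and
          the means agree.\<close>
        have "0 \<le> expectation (\<lambda>x. (f x - Y i x)\<^sup>2)" by simp
        then show ?thesis
          using expectation_square_diff(2)[OF f Ym[OF i] f2 Y2[OF i]] EfY[OF i] VY[OF i] Vf by simp
      qed
      then have "measure_pmf.expectation q (\<lambda>i. variance (Y i)) \<le> measure_pmf.expectation q (\<lambda>i. variance f)"
        by (intro integral_mono_AE integrable_measure_pmf_finite fin) (auto simp: AE_measure_pmf_iff)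
      then show "?s - expectation (\<lambda>x. (Z x)\<^sup>2) \<le> variance f"
        using variance_positive[of Z] unfolding EVY VZ by simp
    qed simp
    finally show ?thesis .
  qed
qed

end

subsection \<open>Random thresholds\<close>

definition threshold :: "real \<Rightarrow> real \<Rightarrow> real" where
  "threshold t z = (if t < z then 1 else -1)"

lemma abs_threshold [simp]: "\<bar>threshold t z\<bar> = 1" "(threshold t z)\<^sup>2 = 1"
  by (simp_all add: threshold_def)

lemma borel_measurable_threshold [measurable (raw)]:
  assumes [measurable]: "f \<in> borel_measurable N" "g \<in> borel_measurable N"
  shows "(\<lambda>x. threshold (f x) (g x)) \<in> borel_measurable N"
  unfolding threshold_def by measurable

text \<open>Both identities are to be read as functions of the level t: the threshold is an affine
  image of an indicator, and two thresholds differ, by 2 in absolute value, exactly for the levels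
  between y and z.\<close>

lemma threshold_indicator:
  "threshold t z = 2 * indicator {..<z} t - 1"
  "(threshold t z - threshold t y)\<^sup>2 = 4 * indicator ({min y z..<max y z}) t"
  by (auto simp: threshold_def indicator_def)

abbreviation uniform_level :: "real measure" where
  "uniform_level \<equiv> uniform_measure lborel {-1..1}"

lemma prob_space_uniform_level: "prob_space uniform_level"
  by (rule prob_space_uniform_measure) auto

text \<open>The levels in [-1, 1] below z have probability (z + 1) / 2. Averaging over the level
  thus recovers z, which is why the level is uniform on precisely this interval.\<close>

lemma expectation_threshold_uniform_level:
  assumes "\<bar>z\<bar> \<le> 1"
  shows "(\<integral>t. threshold t z \<partial>uniform_level) = z"
proof -
  interpret Q: prob_space uniform_level by (rule prob_space_uniform_level)
  have "{-1..1} \<inter> {..<z} = {-1..<z}" using assms by auto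
  then have "measure uniform_level {..<z} = (z + 1) / 2"
    using assms by (subst measure_uniform_measure) auto
  then show ?thesis
    unfolding threshold_indicator(1) by (simp add: Q.prob_space Q.emeasure_eq_measure field_simps)
qed

text \<open>The separating levels form an interval of length \<bar>z - y\<bar>, the density is 1/2
  and the squared jump is 4. There is only an inequality because the interval may extend beyond
  [-1, 1].\<close>

lemma expectation_threshold_diff_uniform_level:
  "(\<integral>t. (threshold t z - threshold t y)\<^sup>2 \<partial>uniform_level) \<le> 2 * \<bar>z - y\<bar>"
proof -
  interpret Q: prob_space uniform_level by (rule prob_space_uniform_level)
  let ?I = "{min y z..<max y z}"
  have "measure uniform_level ?I = measure lborel ({-1..1} \<inter> ?I) / 2"
    by (subst measure_uniform_measure) auto
  also have "\<dots> \<le> measure lborel ?I / 2"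
    by (intro divide_right_mono measure_mono_fmeasurable) (auto simp: fmeasurable_def)
  also have "\<dots> = \<bar>z - y\<bar> / 2" by (auto simp: min_def max_def)
  finally show ?thesis
    unfolding threshold_indicator(2) by simp
qed

context prob_space
begin

lemma expectation_uniform_level_swap:
  fixes f :: "real \<Rightarrow> 'a \<Rightarrow> real"
  assumes [measurable]: "case_prod f \<in> borel_measurable (uniform_level \<Otimes>\<^sub>M M)"
    and bound: "\<And>t x. x \<in> space M \<Longrightarrow> \<bar>f t x\<bar> \<le> B"
  shows "(\<integral>t. expectation (f t) \<partial>uniform_level) = expectation (\<lambda>x. \<integral>t. f t x \<partial>uniform_level)"
    and "integrable uniform_level (\<lambda>t. expectation (f t))"
    and "integrable M (\<lambda>x. \<integral>t. f t x \<partial>uniform_level)"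
proof -
  interpret Q: prob_space uniform_level by (rule prob_space_uniform_level)
  interpret R: pair_prob_space uniform_level M ..
  have int: "integrable (uniform_level \<Otimes>\<^sub>M M) (case_prod f)"
    by (rule R.P.integrable_const_bound[where B = B])
      (auto intro!: AE_I2 bound simp: space_pair_measure)
  show "(\<integral>t. expectation (f t) \<partial>uniform_level) = expectation (\<lambda>x. \<integral>t. f t x \<partial>uniform_level)"
    using R.Fubini_integral[OF int] by simp
  show "integrable uniform_level (\<lambda>t. expectation (f t))"
    by (rule R.integrable_fst[OF int])
  show "integrable M (\<lambda>x. \<integral>t. f t x \<partial>uniform_level)"
    by (rule R.integrable_snd[OF int])
qed

text \<open>A uniformly random level works on average: the covariances of Z with its thresholds
  average to the variance of Z, and thresholding Z and S gives different values with
  probability at most half of the distance of Z and S.\<close>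

lemma exists_threshold:
  fixes Z :: "'a \<Rightarrow> real" and S :: "'l \<Rightarrow> 'a \<Rightarrow> real"
  assumes Z [measurable]: "Z \<in> borel_measurable M" and Z1: "\<And>x. x \<in> space M \<Longrightarrow> \<bar>Z x\<bar> \<le> 1"
    and fin: "finite (set_pmf r)"
    and S: "\<And>l. l \<in> set_pmf r \<Longrightarrow> integrable M (S l)"
    and c: "0 \<le> c"
  shows "\<exists>t. variance Z - 2 * c * measure_pmf.expectation r (\<lambda>l. expectation (\<lambda>x. \<bar>Z x - S l x\<bar>))
    + c * measure_pmf.expectation r (\<lambda>l. expectation (\<lambda>x. (threshold t (Z x) - threshold t (S l x))\<^sup>2))
    \<le> variance (\<lambda>x. threshold t (Z x))"
proof (rule ccontr)
  interpret Q: prob_space uniform_level by (rule prob_space_uniform_level)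
  let ?D = "measure_pmf.expectation r (\<lambda>l. expectation (\<lambda>x. \<bar>Z x - S l x\<bar>))"
  define mm where "mm t l = expectation (\<lambda>x. (threshold t (Z x) - threshold t (S l x))\<^sup>2)" for t l
  define cov where "cov t = expectation (\<lambda>x. (Z x - expectation Z) * threshold t (Z x))" for t
  let ?m = "\<lambda>t. measure_pmf.expectation r (mm t)"
  \<comment> \<open>If every level failed, the strict inequality \<open>neg\<close> would persist
    after averaging over the uniform level.\<close>
  assume "\<not> ?thesis"
  then have neg: "variance (\<lambda>x. threshold t (Z x)) < variance Z - 2 * c * ?D + c * ?m t" for t
    unfolding mm_def by (auto simp: not_le)
  have ZI: "integrable M Z"
    by (rule integrable_const_bound[where B = 1]) (auto intro!: AE_I2 Z1)
  have EZ: "\<bar>expectation Z\<bar> \<le> 1"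
  proof -
    have "\<bar>expectation Z\<bar> \<le> expectation (\<lambda>x. \<bar>Z x\<bar>)" by (rule integral_abs_bound)
    also have "\<dots> \<le> expectation (\<lambda>x. 1)"
      by (intro integral_mono integrable_abs ZI) (auto intro: Z1)
    finally show ?thesis by (simp add: prob_space)
  qed
  have sq: "integrable M (\<lambda>x. (Z x - expectation Z)\<^sup>2)"
  proof (rule integrable_const_bound[where B = 4])
    show "AE x in M. norm ((Z x - expectation Z)\<^sup>2) \<le> 4"
    proof (rule AE_I2)
      fix x assume "x \<in> space M"
      then have "\<bar>Z x - expectation Z\<bar> \<le> 2" using Z1[of x] EZ by linarith
      then have "\<bar>Z x - expectation Z\<bar>\<^sup>2 \<le> 2\<^sup>2" by (intro power_mono) auto
      then show "norm ((Z x - expectation Z)\<^sup>2) \<le> 4" by simp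
    qed
  qed simp
  \<comment> \<open>This is nonnegativity of the variance of Z minus its threshold. It replaces the
    variance of the threshold by a covariance, which is linear in the threshold and hence can be
    averaged over t directly.\<close>
  have covle: "2 * cov t \<le> variance Z + variance (\<lambda>x. threshold t (Z x))" for t
  proof -
    let ?b = "\<lambda>x. threshold t (Z x)"
    have bI: "integrable M ?b" by (rule integrable_const_bound[where B = 1]) auto
    have b2: "integrable M (\<lambda>x. (?b x - expectation ?b)\<^sup>2)"
      using bI by (simp add: power2_diff mult.assoc)
    have prod: "integrable M (\<lambda>x. (Z x - expectation Z) * ?b x)"
      by (rule integrable_mult_of_square_integrable) (use sq in auto)
    have "expectation (\<lambda>x. (Z x - expectation Z) * (?b x - expectation ?b)) =
      expectation (\<lambda>x. (Z x - expectation Z) * ?b x - (Z x - expectation Z) * expectation ?b)"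
      by (simp add: right_diff_distrib)
    also have "\<dots> = cov t"
      unfolding cov_def using prod ZI by (simp add: prob_space)
    finally have *: "expectation (\<lambda>x. (Z x - expectation Z) * (?b x - expectation ?b)) = cov t" .
    have "0 \<le> expectation (\<lambda>x. ((Z x - expectation Z) - (?b x - expectation ?b))\<^sup>2)" by simp
    also have "\<dots> = variance Z - 2 * cov t + variance ?b"
      unfolding *[symmetric] by (rule expectation_square_diff(2)) (use sq b2 in auto)
    finally show ?thesis by simp
  qed
  have cov: "integrable uniform_level cov" "(\<integral>t. cov t \<partial>uniform_level) = variance Z"
  proof -
    have bound: "\<bar>(Z x - expectation Z) * threshold t (Z x)\<bar> \<le> 2" if "x \<in> space M" for t x
      using Z1[OF that] EZ by (simp add: abs_mult)
    show "integrable uniform_level cov"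
      unfolding cov_def[abs_def] by (rule expectation_uniform_level_swap(2)[OF _ bound]) measurable
    have "(\<integral>t. cov t \<partial>uniform_level) =
      expectation (\<lambda>x. \<integral>t. (Z x - expectation Z) * threshold t (Z x) \<partial>uniform_level)"
      unfolding cov_def[abs_def] by (rule expectation_uniform_level_swap(1)[OF _ bound]) measurable
    \<comment> \<open>With the level integrated out first, the threshold turns back into Z.\<close>
    also have "\<dots> = expectation (\<lambda>x. (Z x - expectation Z) * Z x)"
      by (intro Bochner_Integration.integral_cong) (auto simp: expectation_threshold_uniform_level Z1)
    also have "\<dots> = expectation (\<lambda>x. (Z x - expectation Z)\<^sup>2 + (Z x - expectation Z) * expectation Z)"
      by (simp add: power2_eq_square algebra_simps)
    also have "\<dots> = variance Z" using sq ZI by (simp add: prob_space)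
    finally show "(\<integral>t. cov t \<partial>uniform_level) = variance Z" .
  qed
  have mm: "integrable uniform_level (\<lambda>t. mm t l)"
    "(\<integral>t. mm t l \<partial>uniform_level) \<le> 2 * expectation (\<lambda>x. \<bar>Z x - S l x\<bar>)"
    if l: "l \<in> set_pmf r" for l
  proof -
    have [measurable]: "S l \<in> borel_measurable M" using S[OF l] by simp
    have bound: "\<bar>(threshold t u - threshold t v)\<^sup>2\<bar> \<le> 4" for t u v
      by (auto simp: threshold_def)
    show "integrable uniform_level (\<lambda>t. mm t l)"
      unfolding mm_def by (rule expectation_uniform_level_swap(2)[OF _ bound]) measurable
    have "(\<integral>t. mm t l \<partial>uniform_level) =
      expectation (\<lambda>x. \<integral>t. (threshold t (Z x) - threshold t (S l x))\<^sup>2 \<partial>uniform_level)"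
      unfolding mm_def by (rule expectation_uniform_level_swap(1)[OF _ bound]) measurable
    also have "\<dots> \<le> expectation (\<lambda>x. 2 * \<bar>Z x - S l x\<bar>)"
    proof (rule integral_mono)
      show "integrable M (\<lambda>x. \<integral>t. (threshold t (Z x) - threshold t (S l x))\<^sup>2 \<partial>uniform_level)"
        by (rule expectation_uniform_level_swap(3)[OF _ bound]) measurable
    qed (use S[OF l] ZI expectation_threshold_diff_uniform_level in auto)
    finally show "(\<integral>t. mm t l \<partial>uniform_level) \<le> 2 * expectation (\<lambda>x. \<bar>Z x - S l x\<bar>)" by simp
  qed
  note sum_pmf = expectation_finite_pmf[OF fin]
  have mI: "integrable uniform_level ?m"
    unfolding sum_pmf by (intro Bochner_Integration.integrable_sum integrable_mult_right mm)
  have "(\<integral>t. ?m t \<partial>uniform_level) = (\<Sum>l\<in>set_pmf r. pmf r l * (\<integral>t. mm t l \<partial>uniform_level))"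
    unfolding sum_pmf by (simp add: mm)
  also have "\<dots> \<le> (\<Sum>l\<in>set_pmf r. pmf r l * (2 * expectation (\<lambda>x. \<bar>Z x - S l x\<bar>)))"
    by (intro sum_mono mult_left_mono mm) auto
  also have "\<dots> = 2 * ?D" unfolding sum_pmf by (simp add: sum_distrib_left ac_simps)
  finally have "c * (\<integral>t. ?m t \<partial>uniform_level) \<le> c * (2 * ?D)"
    using c by (rule mult_left_mono)
  moreover have "(\<integral>t. 2 * cov t - variance Z - c * ?m t \<partial>uniform_level) =
    variance Z - c * (\<integral>t. ?m t \<partial>uniform_level)"
    using cov mI by (simp add: Q.prob_space)
  \<comment> \<open>\<open>covle\<close> and \<open>neg\<close> give this inequality at every level.
    The same integral was computed just above and is at least the right-hand side, because the mean
    disagreement is at most \<open>2 * ?D\<close>.\<close>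
  moreover have "(\<integral>t. 2 * cov t - variance Z - c * ?m t \<partial>uniform_level) < variance Z - 2 * c * ?D"
  proof (rule Q.expectation_less)
    show "AE t in uniform_level. 2 * cov t - variance Z - c * ?m t < variance Z - 2 * c * ?D"
      using covle neg by (intro AE_I2) (smt (verit))
  qed (use cov mI in simp)
  ultimately show False by simp
qed

end

subsection \<open>Functions of the configuration\<close>

lemma space_gen_alg [simp]: "space (gen_alg N Y U) = space N"
  unfolding gen_alg_def by (rule space_measure_of) auto

lemma sets_gen_alg:
  "sets (gen_alg N Y U) =
    sigma_sets (space N) {Y v -` A \<inter> space N | v A. v \<in> U \<and> A \<in> sets borel}"
  unfolding gen_alg_def by (rule sets_measure_of) auto

lemma subalgebra_gen_alg:
  assumes "\<And>v. v \<in> U \<Longrightarrow> Y v \<in> borel_measurable N"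
  shows "subalgebra N (gen_alg N Y U)"
proof -
  have "sigma_sets (space N) {Y v -` A \<inter> space N | v A. v \<in> U \<and> A \<in> sets borel} \<subseteq> sets N"
    using assms by (intro sets.sigma_sets_subset) (auto intro: measurable_sets)
  then show ?thesis by (simp add: subalgebra_def sets_gen_alg)
qed

lemma measurable_gen_alg_mono:
  assumes "f \<in> borel_measurable (gen_alg N Y U)" "U \<subseteq> W"
  shows "f \<in> borel_measurable (gen_alg N Y W)"
proof -
  have "sets (gen_alg N Y U) \<subseteq> sets (gen_alg N Y W)"
    unfolding sets_gen_alg using assms(2) by (intro sigma_sets_mono') blast
  then show ?thesis using assms(1) by (auto simp: measurable_def)
qed

locale real_process = prob_space M
  for M :: "'s measure" and V :: "'v set" and X :: "'v \<Rightarrow> 's \<Rightarrow> real" +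
  assumes finite_index: "finite V"
    and measurable_process: "v \<in> V \<Longrightarrow> X v \<in> borel_measurable M"
begin

abbreviation observe :: "(('v \<Rightarrow> real) \<Rightarrow> real) \<Rightarrow> 's \<Rightarrow> real" where
  "observe F \<equiv> F \<circ> config V X"

text \<open>The same construction as for the process, applied to the coordinate functions on the
  configuration space. Its measurable functions depend on the configuration through the coordinates
  in the given set.\<close>

abbreviation coordinate_alg :: "'v set \<Rightarrow> ('v \<Rightarrow> real) measure" where
  "coordinate_alg \<equiv> gen_alg (config_space V) (\<lambda>v x. x v)"

lemma measurable_config [measurable]: "config V X \<in> M \<rightarrow>\<^sub>M config_space V"
  unfolding config_def[abs_def] config_space_def
  by (rule measurable_restrict) (rule measurable_process)

lemma subalgebra_process: "U \<subseteq> V \<Longrightarrow> subalgebra M (gen_alg M X U)"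
  by (rule subalgebra_gen_alg) (auto intro: measurable_process)

lemma subalgebra_coordinates: "U \<subseteq> V \<Longrightarrow> subalgebra (config_space V) (coordinate_alg U)"
  unfolding config_space_def by (rule subalgebra_gen_alg) (auto intro: measurable_component_singleton)

text \<open>Coordinate v of the translated configuration is \<open>X (\<pi> v)\<close>. A function
  reading the coordinates in U therefore, after translation, reads the process on the image of
  U.\<close>

lemma measurable_translate_config:
  assumes \<pi>: "\<pi> \<in> V \<rightarrow> V" and U: "U \<subseteq> V"
  shows "(\<lambda>\<omega>. translate V \<pi> (config V X \<omega>)) \<in> gen_alg M X (\<pi> ` U) \<rightarrow>\<^sub>M coordinate_alg U"
proof (rule measurable_sigma_sets[OF sets_gen_alg])
  show "(\<lambda>\<omega>. translate V \<pi> (config V X \<omega>)) \<in> space (gen_alg M X (\<pi> ` U)) \<rightarrow> space (config_space V)"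
    by (auto simp: translate_def config_space_def space_PiM)
  fix B assume "B \<in> {(\<lambda>x. x v) -` A \<inter> space (config_space V) |v A. v \<in> U \<and> A \<in> sets borel}"
  then obtain v A where vA: "B = (\<lambda>x. x v) -` A \<inter> space (config_space V)" "v \<in> U" "A \<in> sets borel"
    by auto
  then have "v \<in> V" "\<pi> v \<in> V" using \<pi> U by auto
  then have "(\<lambda>\<omega>. translate V \<pi> (config V X \<omega>)) -` B \<inter> space (gen_alg M X (\<pi> ` U)) =
    X (\<pi> v) -` A \<inter> space M"
    by (auto simp: vA translate_def config_def config_space_def space_PiM)
  also have "\<dots> \<in> sets (gen_alg M X (\<pi> ` U))"
    unfolding sets_gen_alg using vA by (intro sigma_sets.Basic) auto
  finally show "(\<lambda>\<omega>. translate V \<pi> (config V X \<omega>)) -` B \<inter> space (gen_alg M X (\<pi> ` U))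
    \<in> sets (gen_alg M X (\<pi> ` U))" .
qed auto

lemma measurable_config_coordinates:
  assumes "U \<subseteq> V"
  shows "config V X \<in> gen_alg M X U \<rightarrow>\<^sub>M coordinate_alg U"
proof -
  have "translate V id (config V X \<omega>) = config V X \<omega>" for \<omega>
    by (auto simp: translate_def config_def)
  then show ?thesis using measurable_translate_config[of id U] assms by simp
qed

text \<open>Taking preimages commutes with generating a sigma-algebra, and the generators for the
  process are the preimages under \<open>config V X\<close> of the generators for the
  coordinates.\<close>

lemma sets_gen_alg_vimage:
  assumes U: "U \<subseteq> V" and A: "A \<in> sets (gen_alg M X U)"
  obtains B where "B \<in> sets (coordinate_alg U)" "A = config V X -` B \<inter> space M"
proof -
  let ?G = "{(\<lambda>x. x v) -` A \<inter> space (config_space V) |v A. v \<in> U \<and> A \<in> sets borel}"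
  have cV: "config V X \<in> space M \<rightarrow> space (config_space V)"
    using measurable_space[OF measurable_config] by auto
  have "X v -` A \<inter> space M = config V X -` ((\<lambda>x. x v) -` A \<inter> space (config_space V)) \<inter> space M"
    if "v \<in> U" for v A
    using that U cV by (auto simp: config_def)
  then have "{X v -` A \<inter> space M | v A. v \<in> U \<and> A \<in> sets borel} \<subseteq>
    {config V X -` B \<inter> space M | B. B \<in> ?G}"
    by (smt (verit) Collect_mono mem_Collect_eq)
  then have "sets (gen_alg M X U) \<subseteq> sigma_sets (space M) {config V X -` B \<inter> space M | B. B \<in> ?G}"
    unfolding sets_gen_alg by (rule sigma_sets_mono')
  also have "\<dots> = {config V X -` B \<inter> space M | B. B \<in> sets (coordinate_alg U)}"
    unfolding sets_gen_alg by (rule sigma_sets_vimage_commute[OF cV, symmetric])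
  finally show ?thesis using A that by blast
qed

text \<open>Conditioning on the law of the configuration yields conditional expectations that are
  functions of the configuration. In particular they can be translated.\<close>

lemma real_cond_exp_factorization:
  assumes F: "square_integrable_fun M V X F" and U: "U \<subseteq> V"
  obtains h where "h \<in> borel_measurable (coordinate_alg U)"
    "AE \<omega> in M. real_cond_exp M (gen_alg M X U) (observe F) \<omega> = h (config V X \<omega>)"
proof
  let ?N = "distr M (config_space V) (config V X)"
  interpret N: prob_space ?N by (rule prob_space_distr) simp
  have subN: "subalgebra ?N (coordinate_alg U)"
    using subalgebra_coordinates[OF U] by (simp add: subalgebra_def)
  interpret S: finite_measure_subalgebra ?N "coordinate_alg U" by standard (rule subN)
  interpret T: finite_measure_subalgebra M "gen_alg M X U" by standard (rule subalgebra_process[OF U])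
  have Fm [measurable]: "F \<in> borel_measurable (config_space V)"
    and F2: "integrable M (\<lambda>\<omega>. (observe F \<omega>)\<^sup>2)"
    using F by (simp_all add: square_integrable_fun_def)
  have F1: "integrable M (observe F)"
    by (rule square_integrable_imp_integrable[OF _ F2]) (simp add: comp_def)
  then have FN: "integrable ?N F" by (simp add: integrable_distr_eq comp_def)
  define h where "h = real_cond_exp ?N (coordinate_alg U) F"
  show hm: "h \<in> borel_measurable (coordinate_alg U)" unfolding h_def by simp
  have hN: "integrable ?N h" unfolding h_def by (rule S.real_cond_exp_int(1)[OF FN])
  have [measurable]: "h \<in> borel_measurable (config_space V)"
    using measurable_from_subalg[OF subN hm] by simp
  show "AE \<omega> in M. real_cond_exp M (gen_alg M X U) (observe F) \<omega> = h (config V X \<omega>)"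
  proof (rule T.real_cond_exp_charact)
    show "integrable M (\<lambda>\<omega>. h (config V X \<omega>))" using hN by (simp add: integrable_distr_eq)
    show "(\<lambda>\<omega>. h (config V X \<omega>)) \<in> borel_measurable (gen_alg M X U)"
      using measurable_comp[OF measurable_config_coordinates[OF U] hm] by (simp add: comp_def)
    fix A assume "A \<in> sets (gen_alg M X U)"
    then obtain B where B: "B \<in> sets (coordinate_alg U)" "A = config V X -` B \<inter> space M"
      using sets_gen_alg_vimage[OF U] by blast
    then have [measurable]: "B \<in> sets (config_space V)"
      using subalgebra_coordinates[OF U] by (auto simp: subalgebra_def)
    have ind: "indicator A \<omega> = (indicator B (config V X \<omega>) :: real)" if "\<omega> \<in> space M" for \<omega>
      using that by (auto simp: B indicator_def)
    \<comment> \<open>Both integrals in the characterisation of the conditional expectation are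
      moved to the law of the configuration, where h is a conditional expectation by
      definition.\<close>
    have *: "(\<integral>\<omega>\<in>A. u (config V X \<omega>) \<partial>M) = (\<integral>x\<in>B. u x \<partial>?N)"
      if [measurable]: "u \<in> borel_measurable (config_space V)" for u :: "('v \<Rightarrow> real) \<Rightarrow> real"
      unfolding set_lebesgue_integral_def
      by (subst integral_distr) (auto intro!: Bochner_Integration.integral_cong simp: ind)
    show "(\<integral>\<omega>\<in>A. observe F \<omega> \<partial>M) = (\<integral>\<omega>\<in>A. h (config V X \<omega>) \<partial>M)"
      using *[OF Fm] *[of h] S.real_cond_exp_intA[OF FN B(1)] by (simp add: h_def)
  qed (rule F1)
qed

lemma square_integrable_funD:
  assumes "square_integrable_fun M V X F"
  shows "observe F \<in> borel_measurable M" "integrable M (\<lambda>\<omega>. (observe F \<omega>)\<^sup>2)"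
  using assms measurable_comp[OF measurable_config, of F borel]
  by (simp_all add: square_integrable_fun_def)

text \<open>The projection is obtained as a function of the configuration. For F bounded by 1 the
  conditional expectation obeys this bound only almost surely; clipping h to [-1, 1] alters it on a
  null set and makes the bound hold everywhere, so that averages of h and of its translates inherit
  it pointwise.\<close>

lemma L2_projection_ex:
  assumes F: "square_integrable_fun M V X F" and U: "U \<subseteq> V"
  obtains h where "h \<in> borel_measurable (coordinate_alg U)"
    "L2_projection_of (observe F) (observe h)"
    "variance (observe h) = variance (real_cond_exp M (gen_alg M X U) (observe F))"
    "(\<forall>x\<in>space (config_space V). \<bar>F x\<bar> \<le> 1) \<longrightarrow> (\<forall>x. \<bar>h x\<bar> \<le> 1)"
proof -
  let ?p = "real_cond_exp M (gen_alg M X U) (observe F)"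
  note sub = subalgebra_process[OF U]
  interpret T: finite_measure_subalgebra M "gen_alg M X U" by standard (rule sub)
  note f = square_integrable_funD[OF F]
  have f1: "integrable M (observe F)" by (rule square_integrable_imp_integrable[OF f])
  obtain g where g: "g \<in> borel_measurable (coordinate_alg U)" "AE \<omega> in M. ?p \<omega> = g (config V X \<omega>)"
    using real_cond_exp_factorization[OF F U] by blast
  define bdd where "bdd \<longleftrightarrow> (\<forall>x\<in>space (config_space V). \<bar>F x\<bar> \<le> 1)"
  define h where "h = (if bdd then (\<lambda>x. max (-1) (min 1 (g x))) else g)"
  have hm: "h \<in> borel_measurable (coordinate_alg U)" using g(1) by (simp add: h_def)
  then have [measurable]: "h \<in> borel_measurable (config_space V)"
    by (rule measurable_from_subalg[OF subalgebra_coordinates[OF U]])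
  have [measurable]: "observe h \<in> borel_measurable M" by (simp add: comp_def)
  have ae: "AE \<omega> in M. ?p \<omega> = observe h \<omega>"
  proof (cases bdd)
    case True
    then have "-1 \<le> observe F \<omega>" "observe F \<omega> \<le> 1" if "\<omega> \<in> space M" for \<omega>
      using measurable_space[OF measurable_config that] by (fastforce simp: bdd_def abs_le_iff)+
    then have "AE \<omega> in M. -1 \<le> ?p \<omega>" "AE \<omega> in M. ?p \<omega> \<le> 1"
      using f1 by (auto intro!: T.real_cond_exp_ge_c T.real_cond_exp_le_c)
    with g(2) show ?thesis by eventually_elim (simp add: h_def True)
  qed (use g(2) in \<open>simp add: h_def\<close>)
  have [measurable]: "?p \<in> borel_measurable M" by (rule borel_measurable_cond_exp2)
  define Y where "Y = observe h"
  note [measurable] = \<open>observe h \<in> borel_measurable M\<close>[folded Y_def]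
  note ae = ae[folded Y_def]
  have E: "expectation (\<lambda>\<omega>. u \<omega> (?p \<omega>)) = expectation (\<lambda>\<omega>. u \<omega> (Y \<omega>))"
    if [measurable]: "(\<lambda>\<omega>. u \<omega> (?p \<omega>)) \<in> borel_measurable M"
      "(\<lambda>\<omega>. u \<omega> (Y \<omega>)) \<in> borel_measurable M" for u :: "'s \<Rightarrow> real \<Rightarrow> real"
    using ae by (intro integral_cong_AE) auto
  show ?thesis
  proof
    show "h \<in> borel_measurable (coordinate_alg U)" by (rule hm)
    have h2: "integrable M (\<lambda>\<omega>. (Y \<omega>)\<^sup>2)"
      using square_integrable_real_cond_exp[OF sub f] ae
      by (subst integrable_cong_AE[where g = "\<lambda>\<omega>. (?p \<omega>)\<^sup>2"]) (auto simp del: o_apply)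
    have Eh: "expectation Y = expectation ?p"
      using E[of "\<lambda>_ y. y"] by (simp del: o_apply)
    show "L2_projection_of (observe F) (observe h)"
      unfolding Y_def[symmetric] L2_projection_of_def
      using E[of "\<lambda>\<omega> y. observe F \<omega> * y"] E[of "\<lambda>_ y. y\<^sup>2"] h2 f(1) Eh
        T.real_cond_exp_int(2)[OF f1] expectation_square_real_cond_exp[OF sub f]
      by (simp del: o_apply)
    show "variance (observe h) = variance ?p"
      unfolding Y_def[symmetric] Eh by (rule E[of "\<lambda>_ y. (y - expectation ?p)\<^sup>2", symmetric]) auto
    show "(\<forall>x\<in>space (config_space V). \<bar>F x\<bar> \<le> 1) \<longrightarrow> (\<forall>x. \<bar>h x\<bar> \<le> 1)"
      by (auto simp: h_def bdd_def)
  qed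
qed

lemma clue_le_1:
  assumes F: "square_integrable_fun M V X F" and U: "U \<subseteq> V"
  shows "clue M X (observe F) U \<le> 1"
proof (cases "variance (observe F) = 0")
  case False
  with variance_positive[of "observe F"] have "0 < variance (observe F)" by linarith
  with variance_real_cond_exp_le[OF subalgebra_process[OF U] square_integrable_funD[OF F]]
  show ?thesis unfolding clue_def by (simp del: o_apply)
qed (simp add: clue_def del: o_apply)

text \<open>Here g is an arbitrary estimate of F computed from U. As the conditional expectation is
  the best such estimate, the clue is bounded below without computing the conditional expectation of
  F.\<close>

lemma clue_ge:
  assumes F: "square_integrable_fun M V X F" and U: "U \<subseteq> V"
    and g: "g \<in> borel_measurable (gen_alg M X U)" "integrable M (\<lambda>\<omega>. (g \<omega>)\<^sup>2)"
    and pos: "0 < variance (observe F)"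
  shows "1 - expectation (\<lambda>\<omega>. (observe F \<omega> - g \<omega>)\<^sup>2) / variance (observe F) \<le> clue M X (observe F) U"
proof -
  have "1 - expectation (\<lambda>\<omega>. (observe F \<omega> - g \<omega>)\<^sup>2) / variance (observe F) =
    (variance (observe F) - expectation (\<lambda>\<omega>. (observe F \<omega> - g \<omega>)\<^sup>2)) / variance (observe F)"
    using pos by (simp add: diff_divide_distrib del: o_apply)
  also have "\<dots> \<le> variance (real_cond_exp M (gen_alg M X U) (observe F)) / variance (observe F)"
    using variance_diff_le_variance_real_cond_exp[OF subalgebra_process[OF U] square_integrable_funD[OF F] g]
      pos by (intro divide_right_mono) (simp_all del: o_apply)
  finally show ?thesis using pos by (simp add: clue_def del: o_apply)
qed

end

subsection \<open>Amplification by sampling\<close>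

lemma (in prob_space) variance_le_1:
  fixes f :: "'a \<Rightarrow> real"
  assumes [measurable]: "f \<in> borel_measurable M" and f: "\<And>x. x \<in> space M \<Longrightarrow> \<bar>f x\<bar> \<le> 1"
  shows "variance f \<le> 1"
proof -
  have sq: "(f x)\<^sup>2 \<le> 1" if "x \<in> space M" for x
    using f[OF that] by (simp add: abs_square_le_1)
  have "integrable M f" "integrable M (\<lambda>x. (f x)\<^sup>2)"
    using f sq by (auto intro!: integrable_const_bound[where B = 1] AE_I2)
  then have "variance f \<le> expectation (\<lambda>x. (f x)\<^sup>2)" by (simp add: variance_eq)
  also have "\<dots> \<le> expectation (\<lambda>x. 1)"
    using \<open>integrable M (\<lambda>x. (f x)\<^sup>2)\<close> by (intro integral_mono) (auto intro: sq)
  finally show ?thesis by (simp add: prob_space)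
qed

text \<open>The common setting of both kinds of reconstruction. An index is a realisation of the
  random set in the random case and a permutation of V in the invariant case, where \<open>U\<close>
  maps it to the translate of the given set. \<open>H i\<close> represents the projection of F on
  the information in \<open>U i\<close>, the constant c bounds the average share of the variance
  that is explained, and k is the number of samples.\<close>

locale sampled_projections = real_process M V X
  for M :: "'s measure" and V :: "'v set" and X :: "'v \<Rightarrow> 's \<Rightarrow> real" +
  fixes F :: "('v \<Rightarrow> real) \<Rightarrow> real" and q :: "'i pmf" and U :: "'i \<Rightarrow> 'v set"
    and H :: "'i \<Rightarrow> ('v \<Rightarrow> real) \<Rightarrow> real" and c :: real and k :: nat
  assumes F: "square_integrable_fun M V X F"
    and finite_q: "finite (set_pmf q)"
    and U: "i \<in> set_pmf q \<Longrightarrow> U i \<subseteq> V"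
    and H: "i \<in> set_pmf q \<Longrightarrow> H i \<in> borel_measurable (config_space V)"
    and observe_H: "i \<in> set_pmf q \<Longrightarrow> observe (H i) \<in> borel_measurable (gen_alg M X (U i))"
    and projection: "i \<in> set_pmf q \<Longrightarrow> L2_projection_of (observe F) (observe (H i))"
    and c: "0 < c" "c * variance (observe F) \<le>
      measure_pmf.expectation q (\<lambda>i. variance (observe (H i)))"
    and nonconstant: "0 < variance (observe F)"
    and k: "0 < k"
begin

text \<open>This is the operator T applied to F, taken as a function of the configuration.\<close>

definition average :: "('v \<Rightarrow> real) \<Rightarrow> real" where
  "average x = measure_pmf.expectation q (\<lambda>i. H i x)"

definition sample_mean :: "'i list \<Rightarrow> 's \<Rightarrow> real" where
  "sample_mean l \<omega> = (\<Sum>i\<leftarrow>l. observe (H i) \<omega>) / real k"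

abbreviation samples :: "'i list pmf" where
  "samples \<equiv> replicate_pmf k q"

lemma finite_samples: "finite (set_pmf samples)"
  by (rule finite_set_replicate_pmf[OF finite_q])

lemma set_samples: "l \<in> set_pmf samples \<Longrightarrow> set l \<subseteq> set_pmf q"
  by (auto simp: set_replicate_pmf)

lemmas f = square_integrable_funD[OF F]

lemma observe_average: "observe average = (\<lambda>\<omega>. measure_pmf.expectation q (\<lambda>i. observe (H i) \<omega>))"
  by (simp add: average_def fun_eq_iff)

lemma square_integrable_average: "square_integrable_fun M V X average"
proof -
  have "average \<in> borel_measurable (config_space V)"
    unfolding average_def[abs_def] expectation_finite_pmf[OF finite_q]
    using H by (intro borel_measurable_sum borel_measurable_times) auto
  then show ?thesis
    using L2_projection_average(2)[OF f finite_q projection]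
    unfolding square_integrable_fun_def by (simp add: average_def)
qed

lemma variance_average: "c\<^sup>2 * variance (observe F) \<le> variance (observe average)"
  unfolding observe_average
  using L2_projection_average(3)[OF f finite_q projection] c by (simp del: o_apply)

lemma expectation_sample_mean:
  "measure_pmf.expectation samples (\<lambda>l. expectation (\<lambda>\<omega>. (observe average \<omega> - sample_mean l \<omega>)\<^sup>2))
    \<le> variance (observe F) / real k"
  unfolding observe_average sample_mean_def
  using L2_projection_average(4)[OF f finite_q projection k] by (simp del: o_apply)

lemma sample_mean:
  assumes "l \<in> set_pmf samples"
  shows "sample_mean l \<in> borel_measurable (gen_alg M X (\<Union> (U ` set l)))"
    and "sample_mean l \<in> borel_measurable M"
    and "integrable M (\<lambda>\<omega>. (sample_mean l \<omega>)\<^sup>2)"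
    and "\<Union> (U ` set l) \<subseteq> V"
proof -
  let ?S = "\<lambda>l \<omega>. \<Sum>i\<leftarrow>l. observe (H i) \<omega>"
  show UV: "\<Union> (U ` set l) \<subseteq> V" using set_samples[OF assms] U by blast
  have "?S l' \<in> borel_measurable (gen_alg M X (\<Union> (U ` set l)))" if "set l' \<subseteq> set l" for l'
    using that
  proof (induction l')
    case (Cons i l')
    then have "i \<in> set_pmf q" "U i \<subseteq> \<Union> (U ` set l)" using set_samples[OF assms] by auto
    with Cons show ?case
      using measurable_gen_alg_mono[OF observe_H] by (auto intro!: borel_measurable_add simp del: o_apply)
  qed simp
  then show m: "sample_mean l \<in> borel_measurable (gen_alg M X (\<Union> (U ` set l)))"
    unfolding sample_mean_def[abs_def] by (intro borel_measurable_divide) auto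
  then show "sample_mean l \<in> borel_measurable M"
    by (rule measurable_from_subalg[OF subalgebra_process[OF UV]])
  have "?S l' \<in> borel_measurable M \<and> integrable M (\<lambda>\<omega>. (?S l' \<omega>)\<^sup>2)" if "set l' \<subseteq> set_pmf q" for l'
    using that
  proof (induction l')
    case (Cons i l')
    then have IH: "?S l' \<in> borel_measurable M" "integrable M (\<lambda>\<omega>. (?S l' \<omega>)\<^sup>2)"
      and Hi: "observe (H i) \<in> borel_measurable M" "integrable M (\<lambda>\<omega>. (observe (H i) \<omega>)\<^sup>2)"
      using projection[of i] by (auto simp: L2_projection_of_def simp del: o_apply)
    have "integrable M (\<lambda>\<omega>. (observe (H i) \<omega> - - ?S l' \<omega>)\<^sup>2)"
      using IH Hi by (intro expectation_square_diff(1)) (auto simp del: o_apply)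
    then show ?case using IH Hi by (auto intro!: borel_measurable_add simp del: o_apply)
  qed simp
  from this[OF set_samples[OF assms]] show "integrable M (\<lambda>\<omega>. (sample_mean l \<omega>)\<^sup>2)"
    unfolding sample_mean_def by (simp add: power_divide del: o_apply)
qed

text \<open>For each list of samples, \<open>Y l\<close> is an estimate of G from the union. The
  resulting lower bound on the clue is affine in the squared distance, so a bound on the average
  squared distance suffices.\<close>

lemma expected_clue_ge:
  assumes G: "square_integrable_fun M V X G" and pos: "0 < variance (observe G)"
    and Y: "\<And>l. l \<in> set_pmf samples \<Longrightarrow> Y l \<in> borel_measurable (gen_alg M X (\<Union> (U ` set l)))"
      "\<And>l. l \<in> set_pmf samples \<Longrightarrow> integrable M (\<lambda>\<omega>. (Y l \<omega>)\<^sup>2)"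
    and d: "measure_pmf.expectation samples (\<lambda>l. expectation (\<lambda>\<omega>. (observe G \<omega> - Y l \<omega>)\<^sup>2)) \<le> d"
  shows "1 - d / variance (observe G) \<le>
    measure_pmf.expectation samples (\<lambda>l. clue M X (observe G) (\<Union> (U ` set l)))"
proof -
  note int = integrable_measure_pmf_finite[OF finite_samples]
  have "1 - d / variance (observe G) \<le> 1 - measure_pmf.expectation samples
    (\<lambda>l. expectation (\<lambda>\<omega>. (observe G \<omega> - Y l \<omega>)\<^sup>2)) / variance (observe G)"
    using d pos by (intro diff_left_mono divide_right_mono) (auto simp del: o_apply)
  also have "\<dots> = measure_pmf.expectation samples
    (\<lambda>l. 1 - expectation (\<lambda>\<omega>. (observe G \<omega> - Y l \<omega>)\<^sup>2) / variance (observe G))"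
    by (subst Bochner_Integration.integral_diff) (auto intro: int simp del: o_apply)
  also have "\<dots> \<le> measure_pmf.expectation samples (\<lambda>l. clue M X (observe G) (\<Union> (U ` set l)))"
    by (intro integral_mono_AE int)
      (auto simp: AE_measure_pmf_iff simp del: o_apply intro!: clue_ge[OF G sample_mean(4) Y pos])
  finally show ?thesis .
qed

text \<open>The average squared distance is at most Var F / k and the variance of the average is at
  least c^2 Var F. Hence Var F cancels, and the error depends only on k and c.\<close>

lemma expected_clue_average:
  "1 - 1 / (real k * c\<^sup>2) \<le>
    measure_pmf.expectation samples (\<lambda>l. clue M X (observe average) (\<Union> (U ` set l)))"
proof -
  let ?v = "variance (observe F)" and ?w = "variance (observe average)"
  have pos: "0 < c\<^sup>2 * ?v" using c nonconstant by (simp del: o_apply)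
  then have w: "0 < ?w" using variance_average by linarith
  have "(?v / real k) / ?w \<le> (?v / real k) / (c\<^sup>2 * ?v)"
    using pos w variance_average by (intro divide_left_mono) (simp_all del: o_apply)
  also have "\<dots> = 1 / (real k * c\<^sup>2)" using nonconstant by (simp del: o_apply)
  finally have "1 - 1 / (real k * c\<^sup>2) \<le> 1 - (?v / real k) / ?w" by simp
  also have "\<dots> \<le> measure_pmf.expectation samples (\<lambda>l. clue M X (observe average) (\<Union> (U ` set l)))"
    by (rule expected_clue_ge[OF square_integrable_average w sample_mean(1,3) expectation_sample_mean])
  finally show ?thesis .
qed

text \<open>With this e, the squared distance to the sample mean averages at most e^4 and the L^1
  distance at most e^2. A level chosen with weight 1/e loses 2 (1/e) e^2 = 2 e of variance. Since
  the variance of G is at most 1, the weighted disagreement is at most 1 + 2 e, so the disagreement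
  itself is at most e (1 + 2 e).\<close>

lemma expected_clue_threshold_average:
  assumes F1: "\<And>x. x \<in> space (config_space V) \<Longrightarrow> \<bar>F x\<bar> \<le> 1"
    and H1: "\<And>i x. i \<in> set_pmf q \<Longrightarrow> x \<in> space (config_space V) \<Longrightarrow> \<bar>H i x\<bar> \<le> 1"
  defines "e \<equiv> 1 / sqrt (sqrt (real k))"
  obtains G t where "G = (\<lambda>x. threshold t (average x))"
    "square_integrable_fun M V X G"
    "c\<^sup>2 * variance (observe F) - 2 * e \<le> variance (observe G)"
    "0 < variance (observe G) \<longrightarrow> 1 - e * (1 + 2 * e) / variance (observe G) \<le>
      measure_pmf.expectation samples (\<lambda>l. clue M X (observe G) (\<Union> (U ` set l)))"
proof -
  let ?E = "measure_pmf.expectation samples"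
  let ?Z = "observe average"
  note int = integrable_measure_pmf_finite[OF finite_samples]
  have Z [measurable]: "?Z \<in> borel_measurable M" and Z2: "integrable M (\<lambda>\<omega>. (?Z \<omega>)\<^sup>2)"
    using square_integrable_funD[OF square_integrable_average] by auto
  have Z1: "\<bar>?Z \<omega>\<bar> \<le> 1" if "\<omega> \<in> space M" for \<omega>
  proof -
    have "\<bar>average x\<bar> \<le> 1" if x: "x \<in> space (config_space V)" for x
    proof -
      have "\<bar>average x\<bar> \<le> measure_pmf.expectation q (\<lambda>i. \<bar>H i x\<bar>)"
        unfolding average_def by (rule integral_abs_bound)
      also have "\<dots> \<le> measure_pmf.expectation q (\<lambda>i. 1)"
        using H1 x by (intro integral_mono_AE integrable_measure_pmf_finite finite_q)
          (auto simp: AE_measure_pmf_iff)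
      finally show ?thesis by simp
    qed
    then show ?thesis using measurable_space[OF measurable_config that] by simp
  qed
  have e: "0 < e" using k by (simp add: e_def)
  have ee: "e * e = 1 / sqrt (real k)" using k by (simp add: e_def field_simps)
  have eek: "(e * e) * (e * e) = 1 / real k" unfolding ee by simp
  \<comment> \<open>Boundedness of F turns the sampling error Var F / k into at most 1 / k =
    e^4.\<close>
  have "variance (observe F) \<le> 1"
    using F1 measurable_space[OF measurable_config] by (intro variance_le_1[OF f(1)]) auto
  then have "variance (observe F) / real k \<le> (e * e) * (e * e)"
    unfolding eek by (intro divide_right_mono) auto
  with expectation_sample_mean have sq:
    "?E (\<lambda>l. expectation (\<lambda>\<omega>. (?Z \<omega> - sample_mean l \<omega>)\<^sup>2)) \<le> (e * e) * (e * e)"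
    by linarith
  have D: "?E (\<lambda>l. expectation (\<lambda>\<omega>. \<bar>?Z \<omega> - sample_mean l \<omega>\<bar>)) \<le> e * e"
  proof -
    have "expectation (\<lambda>\<omega>. \<bar>?Z \<omega> - sample_mean l \<omega>\<bar>) \<le>
      e * e / 2 + expectation (\<lambda>\<omega>. (?Z \<omega> - sample_mean l \<omega>)\<^sup>2) / (2 * (e * e))"
      if l: "l \<in> set_pmf samples" for l
    proof -
      note S = sample_mean[OF l]
      have i2: "integrable M (\<lambda>\<omega>. (?Z \<omega> - sample_mean l \<omega>)\<^sup>2)"
        by (rule expectation_square_diff(1)[OF Z S(2) Z2 S(3)])
      have i1: "integrable M (\<lambda>\<omega>. ?Z \<omega> - sample_mean l \<omega>)"
        by (rule square_integrable_imp_integrable[OF borel_measurable_diff[OF Z S(2)] i2])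
      \<comment> \<open>The arithmetic-geometric mean inequality, weighted so that both terms
        contribute at most e^2 / 2 once u^2 has mean at most e^4.\<close>
      have am: "\<bar>u\<bar> \<le> e * e / 2 + u\<^sup>2 / (2 * (e * e))" for u
      proof -
        have "0 \<le> (\<bar>u\<bar> - e * e)\<^sup>2" by simp
        then have "2 * (e * e) * \<bar>u\<bar> \<le> (e * e) * (e * e) + u\<^sup>2"
          unfolding power2_diff power2_abs by (simp add: power2_eq_square algebra_simps)
        then show ?thesis using e by (simp add: field_simps)
      qed
      have "expectation (\<lambda>\<omega>. \<bar>?Z \<omega> - sample_mean l \<omega>\<bar>) \<le>
        expectation (\<lambda>\<omega>. e * e / 2 + (?Z \<omega> - sample_mean l \<omega>)\<^sup>2 / (2 * (e * e)))"
        using i1 i2 am by (intro integral_mono) (auto simp del: o_apply)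
      also have "\<dots> = e * e / 2 + expectation (\<lambda>\<omega>. (?Z \<omega> - sample_mean l \<omega>)\<^sup>2) / (2 * (e * e))"
        using i2 by (simp add: prob_space del: o_apply)
      finally show ?thesis .
    qed
    then have "?E (\<lambda>l. expectation (\<lambda>\<omega>. \<bar>?Z \<omega> - sample_mean l \<omega>\<bar>)) \<le>
      ?E (\<lambda>l. e * e / 2 + expectation (\<lambda>\<omega>. (?Z \<omega> - sample_mean l \<omega>)\<^sup>2) / (2 * (e * e)))"
      by (intro integral_mono_AE int) (auto simp: AE_measure_pmf_iff simp del: o_apply)
    also have "\<dots> = e * e / 2 + ?E (\<lambda>l. expectation (\<lambda>\<omega>. (?Z \<omega> - sample_mean l \<omega>)\<^sup>2)) / (2 * (e * e))"
      by (subst Bochner_Integration.integral_add) (auto intro: int simp del: o_apply)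
    also have "\<dots> \<le> e * e / 2 + (e * e) * (e * e) / (2 * (e * e))"
      using sq e by (intro add_left_mono divide_right_mono) auto
    also have "\<dots> = e * e" using e by simp
    finally show ?thesis .
  qed
  have SI: "integrable M (sample_mean l)" if "l \<in> set_pmf samples" for l
    using sample_mean(2,3)[OF that] by (rule square_integrable_imp_integrable)
  \<comment> \<open>The weight 1/e is large enough to force the disagreement down to order e, yet
    small enough for its product with the L^1 distance to vanish as k grows.\<close>
  have "\<exists>t. variance ?Z - 2 * (1 / e) * ?E (\<lambda>l. expectation (\<lambda>\<omega>. \<bar>?Z \<omega> - sample_mean l \<omega>\<bar>))
    + 1 / e * ?E (\<lambda>l. expectation (\<lambda>\<omega>. (threshold t (?Z \<omega>) - threshold t (sample_mean l \<omega>))\<^sup>2))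
    \<le> variance (\<lambda>\<omega>. threshold t (?Z \<omega>))"
    using e by (intro exists_threshold[OF Z Z1 finite_samples SI]) (auto simp del: o_apply)
  then obtain t where t: "variance ?Z - 2 * (1 / e) * ?E (\<lambda>l. expectation (\<lambda>\<omega>. \<bar>?Z \<omega> - sample_mean l \<omega>\<bar>))
    + 1 / e * ?E (\<lambda>l. expectation (\<lambda>\<omega>. (threshold t (?Z \<omega>) - threshold t (sample_mean l \<omega>))\<^sup>2))
    \<le> variance (\<lambda>\<omega>. threshold t (?Z \<omega>))" by (rule exE)
  define G where "G = (\<lambda>x. threshold t (average x))"
  have Gm [measurable]: "G \<in> borel_measurable (config_space V)"
    using square_integrable_average unfolding G_def square_integrable_fun_def
    by (intro borel_measurable_threshold) auto
  have G: "square_integrable_fun M V X G"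
    unfolding square_integrable_fun_def using Gm by (simp add: G_def)
  have G1: "variance (observe G) \<le> 1"
    by (rule variance_le_1[OF square_integrable_funD(1)[OF G]]) (simp add: G_def)
  have GZ: "observe G = (\<lambda>\<omega>. threshold t (?Z \<omega>))" by (simp add: G_def fun_eq_iff)
  let ?mm = "?E (\<lambda>l. expectation (\<lambda>\<omega>. (observe G \<omega> - threshold t (sample_mean l \<omega>))\<^sup>2))"
  have "2 * (1 / e) * ?E (\<lambda>l. expectation (\<lambda>\<omega>. \<bar>?Z \<omega> - sample_mean l \<omega>\<bar>)) \<le> 2 * (1 / e) * (e * e)"
    using D e by (intro mult_left_mono) auto
  also have "\<dots> = 2 * e" using e by simp
  finally have main: "variance ?Z - 2 * e + 1 / e * ?mm \<le> variance (observe G)"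
    unfolding GZ using t by linarith
  show ?thesis
  proof (rule that[OF G_def G _ impI])
    have "0 \<le> 1 / e * ?mm" using e by (intro mult_nonneg_nonneg integral_nonneg) auto
    then show "c\<^sup>2 * variance (observe F) - 2 * e \<le> variance (observe G)"
      using main variance_average by linarith
    \<comment> \<open>In \<open>main\<close> the variance of G is at most 1 and that of the average
      is at least 0.\<close>
    have "1 / e * ?mm \<le> 1 + 2 * e"
      using main G1 variance_positive[of ?Z] by linarith
    then have mm: "?mm \<le> e * (1 + 2 * e)" using e by (simp add: field_simps del: o_apply)
    show "1 - e * (1 + 2 * e) / variance (observe G) \<le>
      ?E (\<lambda>l. clue M X (observe G) (\<Union> (U ` set l)))" if "0 < variance (observe G)"
      using sample_mean(1) by (intro expected_clue_ge[OF G that _ _ mm]) simp_all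
  qed
qed

end

section \<open>Revealment of a union of samples, and amplification for a random set\<close>

lemma expectation_sum_list_replicate_pmf:
  fixes a :: "'i \<Rightarrow> real"
  assumes fin: "finite (set_pmf q)"
  shows "measure_pmf.expectation (replicate_pmf k q) (\<lambda>l. \<Sum>i\<leftarrow>l. a i) =
    real k * measure_pmf.expectation q a"
proof (induction k)
  case (Suc k)
  note int = integrable_measure_pmf_finite[OF fin]
    integrable_measure_pmf_finite[OF finite_set_replicate_pmf[OF fin]]
  show ?case
    unfolding expectation_replicate_pmf_Suc[OF fin] by (simp add: int Suc algebra_simps)
qed simp

text \<open>A union bound: the indicator that j lies in the union is at most the sum of the
  indicators for the k samples, and each of these has mean at most the original revealment.\<close>

lemma revealment_Union_samples:
  assumes "finite V" "V \<noteq> {}" "set_pmf \<U> \<subseteq> Pow V"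
  shows "revealment V (map_pmf (\<lambda>l. \<Union> (set l)) (replicate_pmf k \<U>)) \<le> real k * revealment V \<U>"
proof -
  have fin: "finite (set_pmf \<U>)"
    using assms finite_subset by auto
  have "measure_pmf.prob (map_pmf (\<lambda>l. \<Union> (set l)) (replicate_pmf k \<U>)) {W. j \<in> W} \<le>
    real k * revealment V \<U>" if j: "j \<in> V" for j
  proof -
    have "measure_pmf.prob (map_pmf (\<lambda>l. \<Union> (set l)) (replicate_pmf k \<U>)) {W. j \<in> W} =
      measure_pmf.expectation (replicate_pmf k \<U>) (indicator {l. j \<in> \<Union> (set l)})"
      by (simp add: vimage_def)
    also have "\<dots> \<le> measure_pmf.expectation (replicate_pmf k \<U>) (\<lambda>l. \<Sum>U\<leftarrow>l. indicator {U. j \<in> U} U)"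
    proof (intro integral_mono integrable_measure_pmf_finite finite_set_replicate_pmf fin)
      show "(indicator {l. j \<in> \<Union> (set l)} l :: real) \<le> (\<Sum>U\<leftarrow>l. indicator {U. j \<in> U} U)" for l
      proof (induction l)
        case (Cons U l)
        have "(0 :: real) \<le> (\<Sum>U\<leftarrow>l. indicator {U. j \<in> U} U)" by (rule sum_list_nonneg) auto
        with Cons show ?case by (cases "\<exists>W\<in>set l. j \<in> W") (auto simp: indicator_def)
      qed simp
    qed
    also have "\<dots> = real k * measure_pmf.prob \<U> {U. j \<in> U}"
      unfolding expectation_sum_list_replicate_pmf[OF fin] by simp
    also have "\<dots> \<le> real k * revealment V \<U>"
      unfolding revealment_def using assms j by (intro mult_left_mono Max_ge) auto
    finally show ?thesis .
  qed
  then show ?thesis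
    using assms unfolding revealment_def[of V "map_pmf _ _"] by (subst Max_le_iff) auto
qed

lemma revealment_nonneg:
  assumes "finite V" "V \<noteq> {}"
  shows "0 \<le> revealment V \<U>"
  unfolding revealment_def using assms by (subst Max_ge_iff) auto

context real_process
begin

lemma expected_clue_le_1:
  assumes F: "square_integrable_fun M V X F" and \<U>: "set_pmf \<U> \<subseteq> Pow V"
  shows "expected_clue M X (observe F) \<U> \<le> 1"
proof -
  have fin: "finite (set_pmf \<U>)"
    using \<U> finite_index finite_subset by auto
  have "expected_clue M X (observe F) \<U> \<le> measure_pmf.expectation \<U> (\<lambda>_. 1)"
    unfolding expected_clue_def using \<U>
    by (intro integral_mono_AE integrable_measure_pmf_finite fin)
      (auto simp: AE_measure_pmf_iff intro!: clue_le_1[OF F] simp del: o_apply)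
  then show ?thesis by simp
qed

text \<open>The realisations of the random set serve as their own indices. The expected clue times
  the variance of F is the average variance of the projections, which gives the bound with constant
  c.\<close>

lemma sampled_projections_random_set:
  assumes F: "square_integrable_fun M V X F" and \<U>: "set_pmf \<U> \<subseteq> Pow V"
    and c: "0 < c" "c < expected_clue M X (observe F) \<U>" and k: "0 < k"
  obtains H where "sampled_projections M V X F \<U> (\<lambda>U. U) H c k"
    "(\<forall>x\<in>space (config_space V). \<bar>F x\<bar> \<le> 1) \<longrightarrow> (\<forall>U\<in>set_pmf \<U>. \<forall>x. \<bar>H U x\<bar> \<le> 1)"
proof -
  let ?v = "variance (observe F)"
  have fin: "finite (set_pmf \<U>)"
    using \<U> finite_index finite_subset by auto
  define P where "P U h \<longleftrightarrow> h \<in> borel_measurable (coordinate_alg U) \<and>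
    L2_projection_of (observe F) (observe h) \<and>
    variance (observe h) = variance (real_cond_exp M (gen_alg M X U) (observe F)) \<and>
    ((\<forall>x\<in>space (config_space V). \<bar>F x\<bar> \<le> 1) \<longrightarrow> (\<forall>x. \<bar>h x\<bar> \<le> 1))" for U h
  have "\<exists>h. P U h" if "U \<in> set_pmf \<U>" for U
  proof -
    have "U \<subseteq> V" using that \<U> by auto
    from L2_projection_ex[OF F this] show ?thesis unfolding P_def by (metis (no_types))
  qed
  then have "\<exists>H. \<forall>U\<in>set_pmf \<U>. P U (H U)" by (intro bchoice) blast
  then obtain H where "\<forall>U\<in>set_pmf \<U>. P U (H U)" ..
  note H = bspec[OF this, unfolded P_def]
  \<comment> \<open>A constant F has clue 0 by convention, against the positive lower bound
    c.\<close>
  have v: "?v \<noteq> 0" using c by (auto simp: expected_clue_def clue_def)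
  then have v0: "0 < ?v" using variance_positive[of "observe F"] by linarith
  have "c * ?v \<le> expected_clue M X (observe F) \<U> * ?v"
    using c v0 by (intro mult_right_mono) auto
  also have "\<dots> = measure_pmf.expectation \<U> (\<lambda>U. clue M X (observe F) U * ?v)"
    by (simp add: expected_clue_def del: o_apply)
  also have "\<dots> = measure_pmf.expectation \<U> (\<lambda>U. variance (observe (H U)))"
    using v H by (intro integral_cong_AE) (auto simp: AE_measure_pmf_iff clue_def simp del: o_apply)
  finally have cv: "c * ?v \<le> measure_pmf.expectation \<U> (\<lambda>U. variance (observe (H U)))" .
  have "sampled_projections M V X F \<U> (\<lambda>U. U) H c k"
  proof unfold_locales
    fix U assume U: "U \<in> set_pmf \<U>"
    then show UV: "U \<subseteq> V" using \<U> by auto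
    from H[OF U] have h: "H U \<in> borel_measurable (coordinate_alg U)" by simp
    show "H U \<in> borel_measurable (config_space V)"
      by (rule measurable_from_subalg[OF subalgebra_coordinates[OF UV] h])
    show "observe (H U) \<in> borel_measurable (gen_alg M X U)"
      by (rule measurable_comp[OF measurable_config_coordinates[OF UV] h])
    show "L2_projection_of (observe F) (observe (H U))" using H[OF U] by simp
  qed (fact F fin c(1) k v0 cv)+
  then show ?thesis using that H by blast
qed

lemma amplify_expected_clue:
  assumes F: "square_integrable_fun M V X F" and \<U>: "set_pmf \<U> \<subseteq> Pow V"
    and c: "0 < c" "c < expected_clue M X (observe F) \<U>" and k: "0 < k"
  defines "\<W> \<equiv> map_pmf (\<lambda>l. \<Union> (set l)) (replicate_pmf k \<U>)"
  obtains G where "square_integrable_fun M V X G"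
    "1 - 1 / (real k * c\<^sup>2) \<le> expected_clue M X (observe G) \<W>"
proof -
  obtain H where "sampled_projections M V X F \<U> (\<lambda>U. U) H c k"
    by (rule sampled_projections_random_set[OF F \<U> c k])
  then interpret S: sampled_projections M V X F \<U> "\<lambda>U. U" H c k .
  show ?thesis
    using that[OF S.square_integrable_average] S.expected_clue_average
    by (simp add: expected_clue_def \<W>_def)
qed

text \<open>The clue bound is conditional because, for small k, the lower bound on the variance of G
  can be negative. Positivity is obtained later by taking k large in terms of c and the variance of
  F.\<close>

lemma amplify_expected_clue_boolean:
  assumes F: "square_integrable_fun M V X F" and \<U>: "set_pmf \<U> \<subseteq> Pow V"
    and c: "0 < c" "c < expected_clue M X (observe F) \<U>" and k: "0 < k"
    and F1: "\<And>x. x \<in> space (config_space V) \<Longrightarrow> F x \<in> {-1, 1}"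
  defines "\<W> \<equiv> map_pmf (\<lambda>l. \<Union> (set l)) (replicate_pmf k \<U>)"
    and "e \<equiv> 1 / sqrt (sqrt (real k))"
  obtains G where "square_integrable_fun M V X G" "\<forall>x. G x \<in> {-1, 1}"
    "c\<^sup>2 * variance (observe F) - 2 * e \<le> variance (observe G)"
    "0 < variance (observe G) \<longrightarrow>
      1 - e * (1 + 2 * e) / variance (observe G) \<le> expected_clue M X (observe G) \<W>"
proof -
  have F1': "\<bar>F x\<bar> \<le> 1" if "x \<in> space (config_space V)" for x using F1[OF that] by auto
  obtain H where S: "sampled_projections M V X F \<U> (\<lambda>U. U) H c k"
    and "(\<forall>x\<in>space (config_space V). \<bar>F x\<bar> \<le> 1) \<longrightarrow> (\<forall>U\<in>set_pmf \<U>. \<forall>x. \<bar>H U x\<bar> \<le> 1)"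
    by (rule sampled_projections_random_set[OF F \<U> c k])
  then have H: "\<bar>H U x\<bar> \<le> 1" if "U \<in> set_pmf \<U>" for U x using F1' that by blast
  from S interpret S: sampled_projections M V X F \<U> "\<lambda>U. U" H c k .
  obtain G t where G: "G = (\<lambda>x. threshold t (S.average x))" "square_integrable_fun M V X G"
    "c\<^sup>2 * variance (observe F) - 2 * e \<le> variance (observe G)"
    "0 < variance (observe G) \<longrightarrow> 1 - e * (1 + 2 * e) / variance (observe G) \<le>
      measure_pmf.expectation S.samples (\<lambda>l. clue M X (observe G) (\<Union> ((\<lambda>U. U) ` set l)))"
    by (rule S.expected_clue_threshold_average[OF F1' H, folded e_def])
  have "1 - e * (1 + 2 * e) / variance (observe G) \<le> expected_clue M X (observe G) \<W>"
    if "0 < variance (observe G)"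
    using G(4) that by (simp add: expected_clue_def \<W>_def del: o_apply)
  moreover have "G x \<in> {-1, 1}" for x by (simp add: G(1) threshold_def)
  ultimately show ?thesis using that G(2,3) by blast
qed

end

subsection \<open>Invariant processes\<close>

lemma (in group_action) action_mult:
  assumes "g \<in> carrier G" "h \<in> carrier G"
  shows "\<phi> (g \<otimes> h) = compose E (\<phi> g) (\<phi> h)"
  using group_hom.hom_mult[OF group_hom assms] assms by (simp add: BijGroup_def bij_prop0)

lemma (in group_action) group_G: "group G"
  using group_hom by (simp add: group_hom_def)

text \<open>The group may be infinite, but its elements act as extensional functions from E to E, of
  which there are finitely many. Averages over the group are therefore taken over this
  image.\<close>

lemma (in group_action) finite_image_action:
  assumes "finite E"
  shows "finite (\<phi> ` carrier G)"
proof (rule finite_subset)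
  show "\<phi> ` carrier G \<subseteq> E \<rightarrow>\<^sub>E E"
    using bij_prop0 by (auto simp: Bij_def PiE_def bij_betw_def)
qed (use assms in \<open>simp add: finite_PiE\<close>)

text \<open>Left multiplication in the image of the group: it is injective because
  \<open>\<phi> g\<close> is, and an injective self-map of a finite set is onto.\<close>

lemma (in group_action) bij_betw_compose_image_action:
  assumes fin: "finite E" and g: "g \<in> carrier G"
  shows "bij_betw (compose E (\<phi> g)) (\<phi> ` carrier G) (\<phi> ` carrier G)"
proof -
  have inj: "inj_on (compose E (\<phi> g)) (\<phi> ` carrier G)"
  proof (rule inj_onI)
    fix \<pi> \<rho> assume \<pi>: "\<pi> \<in> \<phi> ` carrier G" and \<rho>: "\<rho> \<in> \<phi> ` carrier G"
      and eq: "compose E (\<phi> g) \<pi> = compose E (\<phi> g) \<rho>"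
    then have B: "\<pi> \<in> Bij E" "\<rho> \<in> Bij E" "\<phi> g \<in> Bij E" using bij_prop0 g by auto
    show "\<pi> = \<rho>"
    proof (rule extensionalityI[of _ E])
      fix v assume v: "v \<in> E"
      with eq have "\<phi> g (\<pi> v) = \<phi> g (\<rho> v)" by (metis compose_eq)
      moreover have "\<pi> v \<in> E" "\<rho> v \<in> E" using B v by (auto simp: Bij_def bij_betw_def)
      ultimately show "\<pi> v = \<rho> v" using B by (auto simp: Bij_def bij_betw_def dest: inj_onD)
    qed (use B in \<open>auto simp: Bij_def\<close>)
  qed
  have "compose E (\<phi> g) ` (\<phi> ` carrier G) \<subseteq> \<phi> ` carrier G"
    using action_mult[OF g] monoid.m_closed[OF group.is_monoid[OF group_G] g] by force
  then have "compose E (\<phi> g) ` (\<phi> ` carrier G) = \<phi> ` carrier G"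
    by (rule endo_inj_surj[OF finite_image_action[OF fin] _ inj])
  with inj show ?thesis by (simp add: bij_betw_def)
qed

text \<open>The order is reversed: the translate by \<pi> of a configuration already translated by
  \<sigma> reads x at \<sigma> (\<pi> v). Translating x by \<open>\<phi> g\<close> beforehand thus
  multiplies each permutation by \<open>\<phi> g\<close> on the left.\<close>

lemma translate_translate:
  assumes "\<pi> \<in> V \<rightarrow> V"
  shows "translate V \<pi> (translate V \<sigma> x) = translate V (compose V \<sigma> \<pi>) x"
  using assms by (auto simp: translate_def compose_def fun_eq_iff restrict_def)

locale invariant_process = real_process M V X + group_action \<Gamma> V \<phi>
  for M :: "'s measure" and V :: "'v set" and X :: "'v \<Rightarrow> 's \<Rightarrow> real"
    and \<Gamma> :: "'g monoid" and \<phi> :: "'g \<Rightarrow> 'v \<Rightarrow> 'v" +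
  assumes invariant_law: "invariant_law \<Gamma> \<phi> M V X"
begin

text \<open>Uniform on the permutations induced by the group. The image of a fixed U under such a
  permutation is a random point of the orbit of U.\<close>

abbreviation orbit_pmf :: "('v \<Rightarrow> 'v) pmf" where
  "orbit_pmf \<equiv> pmf_of_set (\<phi> ` carrier \<Gamma>)"

lemma finite_perms: "finite (\<phi> ` carrier \<Gamma>)"
  by (rule finite_image_action[OF finite_index])

lemma perms_nonempty: "\<phi> ` carrier \<Gamma> \<noteq> {}"
  using monoid.one_closed[OF group.is_monoid[OF group_G]] by blast

lemma set_orbit_pmf [simp]: "set_pmf orbit_pmf = \<phi> ` carrier \<Gamma>"
  by (rule set_pmf_of_set[OF perms_nonempty finite_perms])

lemma perm_closed: "\<pi> \<in> \<phi> ` carrier \<Gamma> \<Longrightarrow> \<pi> \<in> V \<rightarrow> V"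
  using bij_prop0 by (auto simp: Bij_def bij_betw_def)

lemma measurable_translate: "\<pi> \<in> V \<rightarrow> V \<Longrightarrow> translate V \<pi> \<in> config_space V \<rightarrow>\<^sub>M config_space V"
  unfolding translate_def[abs_def] config_space_def
  by (rule measurable_restrict) (auto intro: measurable_component_singleton)

lemma expectation_translate:
  assumes \<pi>: "\<pi> \<in> \<phi> ` carrier \<Gamma>" and u [measurable]: "u \<in> borel_measurable (config_space V)"
  shows "expectation (\<lambda>\<omega>. u (translate V \<pi> (config V X \<omega>))) = expectation (\<lambda>\<omega>. u (config V X \<omega>) :: real)"
    and "integrable M (\<lambda>\<omega>. u (translate V \<pi> (config V X \<omega>))) \<longleftrightarrow> integrable M (\<lambda>\<omega>. u (config V X \<omega>))"
proof -
  have [measurable]: "translate V \<pi> \<circ> config V X \<in> M \<rightarrow>\<^sub>M config_space V"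
    by (rule measurable_comp[OF measurable_config measurable_translate[OF perm_closed[OF \<pi>]]])
  have eq: "distr M (config_space V) (translate V \<pi> \<circ> config V X) = distr M (config_space V) (config V X)"
    using invariant_law \<pi> by (auto simp: invariant_law_def)
  show "expectation (\<lambda>\<omega>. u (translate V \<pi> (config V X \<omega>))) = expectation (\<lambda>\<omega>. u (config V X \<omega>))"
    using arg_cong[OF eq, of "\<lambda>N. integral\<^sup>L N u"] by (simp add: integral_distr)
  show "integrable M (\<lambda>\<omega>. u (translate V \<pi> (config V X \<omega>))) \<longleftrightarrow> integrable M (\<lambda>\<omega>. u (config V X \<omega>))"
    using arg_cong[OF eq, of "\<lambda>N. integrable N u"] by (simp add: integrable_distr_eq)
qed

text \<open>Translating x only permutes the summands, by left multiplication. The identity holds for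
  each x, so the averaged function is invariant everywhere and so is every threshold of it.\<close>

lemma average_translates_invariant:
  fixes h :: "('v \<Rightarrow> real) \<Rightarrow> real"
  assumes g: "g \<in> carrier \<Gamma>"
  shows "measure_pmf.expectation orbit_pmf (\<lambda>\<pi>. h (translate V \<pi> (translate V (\<phi> g) x))) =
    measure_pmf.expectation orbit_pmf (\<lambda>\<pi>. h (translate V \<pi> x))"
proof -
  have "(\<Sum>\<pi>\<in>\<phi> ` carrier \<Gamma>. h (translate V \<pi> (translate V (\<phi> g) x))) =
    (\<Sum>\<pi>\<in>\<phi> ` carrier \<Gamma>. h (translate V (compose V (\<phi> g) \<pi>) x))"
    by (intro sum.cong) (auto simp: translate_translate perm_closed)
  also have "\<dots> = (\<Sum>\<pi>\<in>\<phi> ` carrier \<Gamma>. h (translate V \<pi> x))"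
    by (rule sum.reindex_bij_betw[OF bij_betw_compose_image_action[OF finite_index g]])
  finally show ?thesis by (simp add: integral_pmf_of_set[OF perms_nonempty finite_perms])
qed

text \<open>When F and the law are invariant, translating the projection on U yields a function with
  the same projection identities that is determined by the translate of U. All translates have the
  same variance, so the average explained share of the variance is just the clue of U.\<close>

lemma sampled_projections_translates:
  assumes F: "square_integrable_fun M V X F" and inv: "invariant_fun \<Gamma> \<phi> V F" and U: "U \<subseteq> V"
    and c: "0 < c" "c < clue M X (observe F) U" and k: "0 < k"
  obtains h where "sampled_projections M V X F orbit_pmf (\<lambda>\<pi>. \<pi> ` U) (\<lambda>\<pi> x. h (translate V \<pi> x)) c k"
    "(\<forall>x\<in>space (config_space V). \<bar>F x\<bar> \<le> 1) \<longrightarrow> (\<forall>x. \<bar>h x\<bar> \<le> 1)"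
proof -
  let ?v = "variance (observe F)"
  have v: "?v \<noteq> 0" using c by (auto simp: clue_def)
  then have v0: "0 < ?v" using variance_positive[of "observe F"] by linarith
  obtain h where h: "h \<in> borel_measurable (coordinate_alg U)"
    and proj: "L2_projection_of (observe F) (observe h)"
    and var: "variance (observe h) = variance (real_cond_exp M (gen_alg M X U) (observe F))"
    and h1: "(\<forall>x\<in>space (config_space V). \<bar>F x\<bar> \<le> 1) \<longrightarrow> (\<forall>x. \<bar>h x\<bar> \<le> 1)"
    by (rule L2_projection_ex[OF F U])
  have hm [measurable]: "h \<in> borel_measurable (config_space V)"
    by (rule measurable_from_subalg[OF subalgebra_coordinates[OF U] h])
  have Fm [measurable]: "F \<in> borel_measurable (config_space V)"
    using F by (simp add: square_integrable_fun_def)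
  let ?H = "\<lambda>\<pi> x. h (translate V \<pi> x)"
  have Hvar: "variance (observe (?H \<pi>)) = variance (observe h)" if \<pi>: "\<pi> \<in> \<phi> ` carrier \<Gamma>" for \<pi>
    using expectation_translate(1)[OF \<pi> hm]
      expectation_translate(1)[OF \<pi>, of "\<lambda>x. (h x - expectation (\<lambda>\<omega>. h (config V X \<omega>)))\<^sup>2"]
    by (simp add: comp_def)
  have "c * ?v \<le> variance (observe h)"
    using c v0 unfolding var clue_def by (simp add: field_simps del: o_apply split: if_splits)
  also have "\<dots> = measure_pmf.expectation orbit_pmf (\<lambda>\<pi>. variance (observe h))" by simp
  also have "\<dots> = measure_pmf.expectation orbit_pmf (\<lambda>\<pi>. variance (observe (?H \<pi>)))"
    by (rule integral_cong_AE) (auto simp: AE_measure_pmf_iff Hvar simp del: o_apply)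
  finally have cv: "c * ?v \<le> measure_pmf.expectation orbit_pmf (\<lambda>\<pi>. variance (observe (?H \<pi>)))" .
  have "sampled_projections M V X F orbit_pmf (\<lambda>\<pi>. \<pi> ` U) ?H c k"
  proof unfold_locales
    show "finite (set_pmf orbit_pmf)" using finite_perms by simp
    fix \<pi> assume "\<pi> \<in> set_pmf orbit_pmf"
    then have \<pi>: "\<pi> \<in> \<phi> ` carrier \<Gamma>" by simp
    note cl = perm_closed[OF \<pi>]
    show "\<pi> ` U \<subseteq> V" using cl U by auto
    show Hm: "?H \<pi> \<in> borel_measurable (config_space V)"
      by (rule measurable_compose[OF measurable_translate[OF cl] hm])
    show "observe (?H \<pi>) \<in> borel_measurable (gen_alg M X (\<pi> ` U))"
      using measurable_compose[OF measurable_translate_config[OF cl U] h] by (simp add: comp_def)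
    \<comment> \<open>Invariance of F lets F and h be translated together, after which invariance of
      the law removes the translation from their product.\<close>
    have FX: "F (config V X \<omega>) = F (translate V \<pi> (config V X \<omega>))" if "\<omega> \<in> space M" for \<omega>
      using inv \<pi> measurable_space[OF measurable_config that] by (auto simp: invariant_fun_def)
    have "expectation (\<lambda>\<omega>. observe F \<omega> * observe (?H \<pi>) \<omega>) =
      expectation (\<lambda>\<omega>. F (translate V \<pi> (config V X \<omega>)) * h (translate V \<pi> (config V X \<omega>)))"
      by (intro Bochner_Integration.integral_cong) (auto simp: FX)
    also have "\<dots> = expectation (\<lambda>\<omega>. F (config V X \<omega>) * h (config V X \<omega>))"
      using expectation_translate(1)[OF \<pi>, of "\<lambda>x. F x * h x"] by simp
    finally show "L2_projection_of (observe F) (observe (?H \<pi>))"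
      using proj measurable_comp[OF measurable_config Hm] expectation_translate[OF \<pi> hm]
        expectation_translate[OF \<pi>, of "\<lambda>x. (h x)\<^sup>2"]
      by (simp add: L2_projection_of_def comp_def)
  qed (fact F c(1) k v0 cv)+
  then show ?thesis using that h1 by blast
qed

text \<open>The clue of some sample reaches the mean, and k translates of U cover at most k times as
  many points as U.\<close>

lemma exists_sample:
  assumes b: "b \<le> measure_pmf.expectation (replicate_pmf k orbit_pmf)
      (\<lambda>l. clue M X f (\<Union>\<pi>\<in>set l. \<pi> ` U))" and U: "U \<subseteq> V"
  obtains W where "W \<subseteq> V" "card W \<le> k * card U" "b \<le> clue M X f W"
proof -
  let ?r = "replicate_pmf k orbit_pmf"
  have fin: "finite (set_pmf ?r)" by (rule finite_set_replicate_pmf) (simp add: finite_perms)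
  have "\<exists>l\<in>set_pmf ?r. b \<le> clue M X f (\<Union>\<pi>\<in>set l. \<pi> ` U)"
  proof (rule ccontr)
    assume "\<not> ?thesis"
    then have "measure_pmf.expectation ?r (\<lambda>l. clue M X f (\<Union>\<pi>\<in>set l. \<pi> ` U)) < b"
      by (intro measure_pmf.expectation_less integrable_measure_pmf_finite fin) (auto simp: AE_measure_pmf_iff)
    with b show False by simp
  qed
  then obtain l where l: "l \<in> set_pmf ?r" "b \<le> clue M X f (\<Union>\<pi>\<in>set l. \<pi> ` U)" by blast
  then have len: "length l = k" "set l \<subseteq> \<phi> ` carrier \<Gamma>" by (auto simp: set_replicate_pmf)
  show ?thesis
  proof (rule that[OF _ _ l(2)])
    show "(\<Union>\<pi>\<in>set l. \<pi> ` U) \<subseteq> V" using len perm_closed U by blast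
    have "card (\<Union>\<pi>\<in>set l. \<pi> ` U) \<le> (\<Sum>\<pi>\<in>set l. card (\<pi> ` U))" by (rule card_UN_le) simp
    also have "\<dots> \<le> (\<Sum>\<pi>\<in>set l. card U)"
      using finite_subset[OF U finite_index] by (intro sum_mono card_image_le)
    also have "\<dots> \<le> k * card U" using card_length[of l] len by simp
    finally show "card (\<Union>\<pi>\<in>set l. \<pi> ` U) \<le> k * card U" .
  qed
qed

lemma amplify_clue:
  assumes F: "square_integrable_fun M V X F" and inv: "invariant_fun \<Gamma> \<phi> V F" and U: "U \<subseteq> V"
    and c: "0 < c" "c < clue M X (observe F) U" and k: "0 < k"
  obtains G W where "square_integrable_fun M V X G" "invariant_fun \<Gamma> \<phi> V G"
    "W \<subseteq> V" "card W \<le> k * card U" "1 - 1 / (real k * c\<^sup>2) \<le> clue M X (observe G) W"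
proof -
  obtain h where "sampled_projections M V X F orbit_pmf (\<lambda>\<pi>. \<pi> ` U) (\<lambda>\<pi> x. h (translate V \<pi> x)) c k"
    by (rule sampled_projections_translates[OF F inv U c k])
  then interpret S: sampled_projections M V X F orbit_pmf "\<lambda>\<pi>. \<pi> ` U" "\<lambda>\<pi> x. h (translate V \<pi> x)" c k .
  have "invariant_fun \<Gamma> \<phi> V S.average"
    unfolding invariant_fun_def S.average_def by (auto simp: average_translates_invariant)
  with exists_sample[OF S.expected_clue_average U] that S.square_integrable_average
  show ?thesis by metis
qed

text \<open>The smallness of e makes the variance of G positive, so the bound on the expected clue
  is unconditional and a good realisation of the union can be selected.\<close>

lemma amplify_clue_boolean:
  assumes F: "square_integrable_fun M V X F" and inv: "invariant_fun \<Gamma> \<phi> V F" and U: "U \<subseteq> V"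
    and c: "0 < c" "c < clue M X (observe F) U" and k: "0 < k"
    and F1: "\<And>x. x \<in> space (config_space V) \<Longrightarrow> F x \<in> {-1, 1}"
  defines "e \<equiv> 1 / sqrt (sqrt (real k))"
  assumes e: "2 * e < c\<^sup>2 * variance (observe F)"
  obtains G W where "square_integrable_fun M V X G" "invariant_fun \<Gamma> \<phi> V G" "\<forall>x. G x \<in> {-1, 1}"
    "W \<subseteq> V" "card W \<le> k * card U"
    "c\<^sup>2 * variance (observe F) - 2 * e \<le> variance (observe G)"
    "1 - e * (1 + 2 * e) / variance (observe G) \<le> clue M X (observe G) W"
proof -
  have F1': "\<bar>F x\<bar> \<le> 1" if "x \<in> space (config_space V)" for x using F1[OF that] by auto
  obtain h where S: "sampled_projections M V X F orbit_pmf (\<lambda>\<pi>. \<pi> ` U) (\<lambda>\<pi> x. h (translate V \<pi> x)) c k"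
    and "(\<forall>x\<in>space (config_space V). \<bar>F x\<bar> \<le> 1) \<longrightarrow> (\<forall>x. \<bar>h x\<bar> \<le> 1)"
    by (rule sampled_projections_translates[OF F inv U c k])
  then have h: "\<bar>h x\<bar> \<le> 1" for x using F1' by blast
  from S interpret S: sampled_projections M V X F orbit_pmf "\<lambda>\<pi>. \<pi> ` U" "\<lambda>\<pi> x. h (translate V \<pi> x)" c k .
  obtain G t where G: "G = (\<lambda>x. threshold t (S.average x))" "square_integrable_fun M V X G"
    "c\<^sup>2 * variance (observe F) - 2 * e \<le> variance (observe G)"
    "0 < variance (observe G) \<longrightarrow> 1 - e * (1 + 2 * e) / variance (observe G) \<le>
      measure_pmf.expectation S.samples (\<lambda>l. clue M X (observe G) (\<Union>\<pi>\<in>set l. \<pi> ` U))"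
    by (rule S.expected_clue_threshold_average[OF F1' h, folded e_def])
  have "1 - e * (1 + 2 * e) / variance (observe G) \<le>
    measure_pmf.expectation S.samples (\<lambda>l. clue M X (observe G) (\<Union>\<pi>\<in>set l. \<pi> ` U))"
    using G(3,4) e by linarith
  then obtain W where W: "W \<subseteq> V" "card W \<le> k * card U"
    "1 - e * (1 + 2 * e) / variance (observe G) \<le> clue M X (observe G) W"
    by (rule exists_sample[OF _ U])
  have "invariant_fun \<Gamma> \<phi> V G"
    unfolding invariant_fun_def G(1) S.average_def by (auto simp: average_translates_invariant)
  moreover have "G x \<in> {-1, 1}" for x by (simp add: G(1) threshold_def)
  ultimately show ?thesis using that G(2,3) W by blast
qed

end

subsection \<open>Partial reconstruction implies full reconstruction\<close>

text \<open>Up to rounding and the additive constant K, k is the inverse square root of a positive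
  null sequence \<open>a\<close> dominating \<delta>; then k \<delta> is at most of the order of the
  square root of \<open>a\<close>.\<close>

lemma exists_slow_growth:
  fixes \<delta> :: "nat \<Rightarrow> real"
  assumes \<delta>: "\<delta> \<longlonglongrightarrow> 0"
  obtains k :: "nat \<Rightarrow> nat" where "filterlim k at_top sequentially"
    "(\<lambda>n. real (k n) * \<delta> n) \<longlonglongrightarrow> 0" "\<And>n. K \<le> k n"
proof -
  \<comment> \<open>The second summand keeps \<open>a\<close> positive where \<delta> vanishes, so
    that its inverse square root makes sense.\<close>
  define a where "a n = \<bar>\<delta> n\<bar> + 1 / real (Suc n)" for n
  have a0: "a n > 0" for n by (auto simp: a_def intro!: add_nonneg_pos)
  have "a \<longlonglongrightarrow> 0 + 0"
    unfolding a_def[abs_def] by (intro tendsto_add tendsto_rabs_zero \<delta> LIMSEQ_Suc[OF lim_1_over_n])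
  then have a: "a \<longlonglongrightarrow> 0" by simp
  then have sa: "(\<lambda>n. sqrt (a n)) \<longlonglongrightarrow> 0" using tendsto_real_sqrt[OF a] by simp
  define k where "k n = nat \<lceil>1 / sqrt (a n)\<rceil> + K" for n
  have k: "1 / sqrt (a n) \<le> real (k n)" "real (k n) \<le> 1 / sqrt (a n) + 1 + real K" for n
    using a0[of n] unfolding k_def by (auto simp: of_nat_ceiling intro: add_increasing2)
  have "filterlim (\<lambda>n. sqrt (a n)) (at_right 0) sequentially"
    using sa a0 by (auto simp: filterlim_at less_imp_neq[OF a0, symmetric] intro!: always_eventually)
  then have "filterlim (\<lambda>n. inverse (sqrt (a n))) at_top sequentially"
    by (rule filterlim_compose[OF filterlim_inverse_at_top_right])
  then have "filterlim (\<lambda>n. real (k n)) at_top sequentially"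
    using k(1) by (elim filterlim_at_top_mono) (simp add: field_simps)
  then have top: "filterlim k at_top sequentially"
    unfolding filterlim_at_top
  proof safe
    fix Z :: nat
    assume "\<forall>Z. \<forall>\<^sub>F n in sequentially. Z \<le> real (k n)"
    then show "\<forall>\<^sub>F n in sequentially. Z \<le> k n" by (auto dest: spec[of _ "real Z"])
  qed
  have bound: "\<bar>real (k n) * \<delta> n\<bar> \<le> sqrt (a n) + (1 + real K) * a n" for n
  proof -
    have "\<bar>\<delta> n\<bar> \<le> a n" by (simp add: a_def)
    then have "\<bar>real (k n) * \<delta> n\<bar> \<le> real (k n) * a n" by (simp add: abs_mult mult_left_mono)
    also have "\<dots> \<le> (1 / sqrt (a n) + 1 + real K) * a n"
      using k(2)[of n] a0[of n] by (intro mult_right_mono) auto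
    also have "\<dots> = a n / sqrt (a n) + (1 + real K) * a n" by (simp add: algebra_simps)
    also have "a n / sqrt (a n) = sqrt (a n)" using a0[of n] by (simp add: real_div_sqrt)
    finally show ?thesis .
  qed
  have "(\<lambda>n. sqrt (a n) + (1 + real K) * a n) \<longlonglongrightarrow> 0 + (1 + real K) * 0"
    by (intro tendsto_add tendsto_mult sa a tendsto_const)
  then have "(\<lambda>n. sqrt (a n) + (1 + real K) * a n) \<longlonglongrightarrow> 0" by simp
  then have "(\<lambda>n. real (k n) * \<delta> n) \<longlonglongrightarrow> 0"
    by (rule Lim_null_comparison[rotated]) (use bound in \<open>auto intro!: always_eventually\<close>)
  then show ?thesis using that top by (simp add: k_def)
qed

text \<open>The number of samples is allowed to depend on n: it tends to infinity, so the error
  vanishes, but slowly enough for the revealment to vanish too. The predicate Q carries the extra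
  demands of the non-degenerate case, and K ensures that they and the lower bound on the expected
  clue hold for every n, not just eventually.\<close>

lemma full_RSR_by_amplification:
  assumes process: "\<And>n. real_process (P n) (V n) (X n)"
    and V: "filterlim (\<lambda>n. card (V n)) at_top sequentially"
    and RSR: "RSR_by P V X F \<U>"
    and err: "err \<longlonglongrightarrow> 0" "\<And>k. K \<le> k \<Longrightarrow> err k < 1 / 2"
    and amp: "\<And>n k. K \<le> k \<Longrightarrow> \<exists>G. square_integrable_fun (P n) (V n) (X n) G \<and> Q n G \<and>
      1 - err k \<le> expected_clue (P n) (X n) (G \<circ> config (V n) (X n))
        (map_pmf (\<lambda>l. \<Union> (set l)) (replicate_pmf k (\<U> n)))"
  obtains G \<W> where "full_RSR_by P V X G \<W>" "\<forall>n. Q n (G n)"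
proof -
  have \<U>: "set_pmf (\<U> n) \<subseteq> Pow (V n)" and \<delta>: "(\<lambda>n. revealment (V n) (\<U> n)) \<longlonglongrightarrow> 0" for n
    using RSR by (auto simp: RSR_by_def)
  have fin: "finite (V n)" for n
    using process[of n] by (simp add: real_process_def real_process_axioms_def)
  obtain k :: "nat \<Rightarrow> nat" where k: "filterlim k at_top sequentially"
    "(\<lambda>n. real (k n) * revealment (V n) (\<U> n)) \<longlonglongrightarrow> 0" "\<And>n. K \<le> k n"
    using exists_slow_growth[OF \<delta>] by metis
  define \<W> where "\<W> n = map_pmf (\<lambda>l. \<Union> (set l)) (replicate_pmf (k n) (\<U> n))" for n
  have "\<forall>n. \<exists>G. square_integrable_fun (P n) (V n) (X n) G \<and> Q n G \<and>
      1 - err (k n) \<le> expected_clue (P n) (X n) (G \<circ> config (V n) (X n)) (\<W> n)"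
    unfolding \<W>_def by (intro allI amp k(3))
  from choice[OF this]
  obtain G where G: "\<And>n. square_integrable_fun (P n) (V n) (X n) (G n)" "\<And>n. Q n (G n)"
    "\<And>n. 1 - err (k n) \<le> expected_clue (P n) (X n) (G n \<circ> config (V n) (X n)) (\<W> n)"
    by blast
  have \<W>: "set_pmf (\<W> n) \<subseteq> Pow (V n)" for n
    using \<U>[of n] by (fastforce simp: \<W>_def set_replicate_pmf)
  \<comment> \<open>Revealment is a maximum over \<open>V n\<close>, whose bounds require a nonempty
    set; growth of the index sets provides this eventually, which is enough for the limit.\<close>
  have "\<forall>\<^sub>F n in sequentially. 1 \<le> card (V n)" using V by (simp add: filterlim_at_top)
  then have nonempty: "\<forall>\<^sub>F n in sequentially. V n \<noteq> {}" by (rule eventually_mono) auto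
  have rev: "(\<lambda>n. revealment (V n) (\<W> n)) \<longlonglongrightarrow> 0"
  proof (rule tendsto_sandwich[OF _ _ tendsto_const k(2)])
    show "\<forall>\<^sub>F n in sequentially. 0 \<le> revealment (V n) (\<W> n)"
      using nonempty by (rule eventually_mono) (rule revealment_nonneg[OF fin])
    show "\<forall>\<^sub>F n in sequentially. revealment (V n) (\<W> n) \<le> real (k n) * revealment (V n) (\<U> n)"
      using nonempty unfolding \<W>_def
      by (rule eventually_mono) (rule revealment_Union_samples[OF fin _ \<U>])
  qed
  have "(\<lambda>n. 1 - err (k n)) \<longlonglongrightarrow> 1 - 0"
    by (intro tendsto_diff tendsto_const filterlim_compose[OF err(1) k(1)])
  then have lim: "(\<lambda>n. 1 - err (k n)) \<longlonglongrightarrow> 1" by simp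
  have "(\<lambda>n. expected_clue (P n) (X n) (G n \<circ> config (V n) (X n)) (\<W> n)) \<longlonglongrightarrow> 1"
    by (rule tendsto_sandwich[OF _ _ lim tendsto_const])
      (intro always_eventually allI G(3), intro always_eventually allI real_process.expected_clue_le_1 process G(1) \<W>)
  \<comment> \<open>The definition asks for one positive lower bound valid for all n; keeping the
    error below 1/2 supplies it.\<close>
  moreover have "1 / 2 < expected_clue (P n) (X n) (G n \<circ> config (V n) (X n)) (\<W> n)" for n
    using G(3)[of n] err(2)[OF k(3), of n] by linarith
  then have "\<exists>c>0. \<forall>n. c < expected_clue (P n) (X n) (G n \<circ> config (V n) (X n)) (\<W> n)"
    by (intro exI[of _ "1 / 2"]) auto
  ultimately have "full_RSR_by P V X G \<W>"
    using G(1) \<W> rev by (simp add: full_RSR_by_def RSR_by_def)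
  then show ?thesis using that G(2) by blast
qed

text \<open>A positive liminf bounds the clue from below only eventually. At the remaining n the
  original function and set are retained, which is why Q is also assumed of \<open>F n\<close>; the
  limits are unaffected.\<close>

lemma full_SR_by_amplification:
  assumes process: "\<And>n. real_process (P n) (V n) (X n)"
    and SR: "SR_by \<Gamma> \<phi> P V X F U" and Q: "\<And>n. Q n (F n)"
    and err: "err \<longlonglongrightarrow> 0"
    and c: "\<forall>\<^sub>F n in sequentially. c < clue (P n) (X n) (F n \<circ> config (V n) (X n)) (U n)"
    and amp: "\<And>n k. K \<le> k \<Longrightarrow> c < clue (P n) (X n) (F n \<circ> config (V n) (X n)) (U n) \<Longrightarrow>
      \<exists>G W. square_integrable_fun (P n) (V n) (X n) G \<and> invariant_fun (\<Gamma> n) (\<phi> n) (V n) G \<and>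
        W \<subseteq> V n \<and> card W \<le> k * card (U n) \<and> Q n G \<and>
        1 - err k \<le> clue (P n) (X n) (G \<circ> config (V n) (X n)) W"
  obtains G W where "full_SR_by \<Gamma> \<phi> P V X G W" "\<forall>n. Q n (G n)"
proof -
  have F: "square_integrable_fun (P n) (V n) (X n) (F n)" "invariant_fun (\<Gamma> n) (\<phi> n) (V n) (F n)"
    and U: "U n \<subseteq> V n" and \<delta>: "(\<lambda>n. real (card (U n)) / real (card (V n))) \<longlonglongrightarrow> 0" for n
    using SR by (auto simp: SR_by_def)
  obtain k :: "nat \<Rightarrow> nat" where k: "filterlim k at_top sequentially"
    "(\<lambda>n. real (k n) * (real (card (U n)) / real (card (V n)))) \<longlonglongrightarrow> 0" "\<And>n. max 1 K \<le> k n"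
    using exists_slow_growth[OF \<delta>] by metis
  have "\<exists>G W. square_integrable_fun (P n) (V n) (X n) G \<and> invariant_fun (\<Gamma> n) (\<phi> n) (V n) G \<and>
        W \<subseteq> V n \<and> card W \<le> k n * card (U n) \<and> Q n G \<and>
        (c < clue (P n) (X n) (F n \<circ> config (V n) (X n)) (U n) \<longrightarrow>
          1 - err (k n) \<le> clue (P n) (X n) (G \<circ> config (V n) (X n)) W)" for n
  proof (cases "c < clue (P n) (X n) (F n \<circ> config (V n) (X n)) (U n)")
    case True
    then show ?thesis using amp[of "k n" n] k(3)[of n] by auto
  next
    case False
    \<comment> \<open>The retained set obeys the same size bound because \<open>k n\<close> is at
      least 1.\<close>
    have "card (U n) \<le> k n * card (U n)" using k(3)[of n] by simp
    with False F U Q show ?thesis by blast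
  qed
  then obtain G W where G: "\<And>n. square_integrable_fun (P n) (V n) (X n) (G n)"
      "\<And>n. invariant_fun (\<Gamma> n) (\<phi> n) (V n) (G n)" "\<And>n. Q n (G n)"
    and W: "\<And>n. W n \<subseteq> V n" "\<And>n. card (W n) \<le> k n * card (U n)"
    and GW: "\<And>n. c < clue (P n) (X n) (F n \<circ> config (V n) (X n)) (U n) \<Longrightarrow>
          1 - err (k n) \<le> clue (P n) (X n) (G n \<circ> config (V n) (X n)) (W n)"
    by metis
  have "real (card (W n)) / real (card (V n)) \<le> real (k n) * (real (card (U n)) / real (card (V n)))" for n
    using W(2)[of n] by (simp add: divide_right_mono flip: of_nat_mult)
  then have rev: "(\<lambda>n. real (card (W n)) / real (card (V n))) \<longlonglongrightarrow> 0"
    by (intro tendsto_sandwich[OF _ _ tendsto_const k(2)]) (auto intro: always_eventually)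
  have "(\<lambda>n. 1 - err (k n)) \<longlonglongrightarrow> 1 - 0"
    by (intro tendsto_diff tendsto_const filterlim_compose[OF err k(1)])
  then have lim: "(\<lambda>n. 1 - err (k n)) \<longlonglongrightarrow> 1" by simp
  have one: "(\<lambda>n. clue (P n) (X n) (G n \<circ> config (V n) (X n)) (W n)) \<longlonglongrightarrow> 1"
  proof (rule tendsto_sandwich[OF _ _ lim tendsto_const])
    show "\<forall>\<^sub>F n in sequentially. 1 - err (k n) \<le> clue (P n) (X n) (G n \<circ> config (V n) (X n)) (W n)"
      using c by (rule eventually_mono) (rule GW)
    show "\<forall>\<^sub>F n in sequentially. clue (P n) (X n) (G n \<circ> config (V n) (X n)) (W n) \<le> 1"
      by (intro always_eventually allI real_process.clue_le_1 process G W)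
  qed
  then have "liminf (\<lambda>n. ereal (clue (P n) (X n) (G n \<circ> config (V n) (X n)) (W n))) = ereal 1"
    by (intro lim_imp_Liminf) auto
  then have "full_SR_by \<Gamma> \<phi> P V X G W"
    using G(1,2) W(1) rev one by (simp add: full_SR_by_def SR_by_def)
  then show ?thesis using that G(3) by blast
qed

lemma SR_by_eventually_clue:
  assumes "SR_by \<Gamma> \<phi> P V X F U"
  obtains c where "0 < c"
    "\<forall>\<^sub>F n in sequentially. c < clue (P n) (X n) (F n \<circ> config (V n) (X n)) (U n)"
proof -
  have "0 < liminf (\<lambda>n. ereal (clue (P n) (X n) (F n \<circ> config (V n) (X n)) (U n)))"
    using assms by (simp add: SR_by_def)
  then obtain c where c: "0 < ereal c"
    "ereal c < liminf (\<lambda>n. ereal (clue (P n) (X n) (F n \<circ> config (V n) (X n)) (U n)))"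
    using ereal_dense2 by blast
  show ?thesis
    using that[of c] c(1) less_LiminfD[OF c(2)] by simp
qed

lemma tendsto_average_error:
  fixes c :: real
  assumes "0 < c"
  shows "(\<lambda>k. 1 / (real k * c\<^sup>2)) \<longlonglongrightarrow> 0"
  using tendsto_mult[OF lim_1_over_n tendsto_const[of "1 / c\<^sup>2"]] by simp

lemma tendsto_threshold_error:
  "(\<lambda>k. 1 / sqrt (sqrt (real k))) \<longlonglongrightarrow> 0"
  "(\<lambda>k. 1 / sqrt (sqrt (real k)) * (1 + 2 * (1 / sqrt (sqrt (real k)))) / v) \<longlonglongrightarrow> 0"
proof -
  have "filterlim (\<lambda>k. sqrt (sqrt (real k))) at_top sequentially"
    by (intro filterlim_compose[OF sqrt_at_top] filterlim_real_sequentially)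
  from tendsto_inverse_0_at_top[OF this] show *: "(\<lambda>k. 1 / sqrt (sqrt (real k))) \<longlonglongrightarrow> 0"
    by (simp add: inverse_eq_divide)
  have "(\<lambda>k. 1 / sqrt (sqrt (real k)) * (1 + 2 * (1 / sqrt (sqrt (real k)))) * (1 / v)) \<longlonglongrightarrow>
    0 * (1 + 2 * 0) * (1 / v)"
    by (intro tendsto_mult tendsto_add tendsto_const *)
  then show "(\<lambda>k. 1 / sqrt (sqrt (real k)) * (1 + 2 * (1 / sqrt (sqrt (real k)))) / v) \<longlonglongrightarrow> 0"
    by simp
qed

lemma eventually_less_both:
  fixes f g :: "nat \<Rightarrow> real"
  assumes "f \<longlonglongrightarrow> 0" "0 < a" "g \<longlonglongrightarrow> 0" "0 < b"
  obtains K where "0 < K" "\<And>k. K \<le> k \<Longrightarrow> f k < a" "\<And>k. K \<le> k \<Longrightarrow> g k < b"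
proof -
  have "\<forall>\<^sub>F k in sequentially. f k < a \<and> g k < b"
    using assms by (intro eventually_conj order_tendstoD(2))
  then obtain K where "\<And>k. K \<le> k \<Longrightarrow> f k < a \<and> g k < b" by (auto simp: eventually_sequentially)
  then show ?thesis using that[of "max 1 K"] by auto
qed

theorem theorem3p9:
  fixes \<Omega> :: "'a measure"
    and V :: "nat \<Rightarrow> 'v set"
    and P :: "nat \<Rightarrow> ('v \<Rightarrow> 'a) measure"
    and X :: "nat \<Rightarrow> 'v \<Rightarrow> ('v \<Rightarrow> 'a) \<Rightarrow> real"
    and \<Gamma> :: "nat \<Rightarrow> 'g monoid"
    and \<phi> :: "nat \<Rightarrow> 'g \<Rightarrow> 'v \<Rightarrow> 'v"
  assumes "\<And>n. finite (V n)"
    and "filterlim (\<lambda>n. card (V n)) at_top sequentially"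
    and "\<And>n. prob_space (P n)"
    and "\<And>n. sets (P n) = sets (PiM (V n) (\<lambda>_. \<Omega>))"
    and "\<And>n v. v \<in> V n \<Longrightarrow> X n v \<in> borel_measurable (P n)"
    and "\<And>n v. v \<in> V n \<Longrightarrow> integrable (P n) (\<lambda>\<omega>. (X n v \<omega>)\<^sup>2)"
  shows "(RSR P V X \<longrightarrow> full_RSR P V X) \<and>
         (nondegenerate_RSR P V X \<longrightarrow> full_nondegenerate_RSR P V X) \<and>
         ((\<forall>n. transitive_action (\<Gamma> n) (V n) (\<phi> n) \<and>
               invariant_law (\<Gamma> n) (\<phi> n) (P n) (V n) (X n)) \<longrightarrow>
            (SR \<Gamma> \<phi> P V X \<longrightarrow> full_SR \<Gamma> \<phi> P V X) \<and>
            (nondegenerate_SR \<Gamma> \<phi> P V X \<longrightarrow> full_nondegenerate_SR \<Gamma> \<phi> P V X))"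
proof (intro conjI impI)
  have process: "real_process (P n) (V n) (X n)" for n
    using assms(1,3,5) by (simp add: real_process_def real_process_axioms_def)
  let ?e = "\<lambda>k. 1 / sqrt (sqrt (real k))"
  let ?clue = "\<lambda>n G. clue (P n) (X n) (G \<circ> config (V n) (X n))"
  let ?eclue = "\<lambda>n G. expected_clue (P n) (X n) (G \<circ> config (V n) (X n))"
  let ?var = "\<lambda>n G. prob_space.variance (P n) (G \<circ> config (V n) (X n))"
  let ?sq = "\<lambda>n. square_integrable_fun (P n) (V n) (X n)"
  let ?\<W> = "\<lambda>k \<U>. map_pmf (\<lambda>l. \<Union> (set l)) (replicate_pmf k \<U>)"

  show "full_RSR P V X" if RSR: "RSR P V X"
  proof -
    obtain F \<U> where R: "RSR_by P V X F \<U>" using RSR by (auto simp: RSR_def)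
    then have F: "?sq n (F n)" and \<U>: "set_pmf (\<U> n) \<subseteq> Pow (V n)" for n
      by (simp_all add: RSR_by_def)
    have "\<exists>c>0. \<forall>n. c < ?eclue n (F n) (\<U> n)" using R by (simp add: RSR_by_def)
    then obtain c where c: "0 < c" "\<And>n. c < ?eclue n (F n) (\<U> n)" by blast
    let ?err = "\<lambda>k. 1 / (real k * c\<^sup>2)"
    note err = tendsto_average_error[OF c(1)]
    obtain K where K: "0 < K" "\<And>k. K \<le> k \<Longrightarrow> ?err k < 1 / 2"
      by (rule eventually_less_both[OF err _ err, of "1 / 2" 1]) auto
    have "\<exists>G. ?sq n G \<and> True \<and> 1 - ?err k \<le> ?eclue n G (?\<W> k (\<U> n))" if "K \<le> k" for n k
    proof -
      have "0 < k" using K that by simp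
      then obtain G where "?sq n G" "1 - ?err k \<le> ?eclue n G (?\<W> k (\<U> n))"
        by (rule real_process.amplify_expected_clue[OF process F \<U> c])
      then show ?thesis by blast
    qed
    note amp = this
    obtain G \<W> where "full_RSR_by P V X G \<W>"
      by (rule full_RSR_by_amplification[where Q = "\<lambda>_ _. True", OF process assms(2) R err K(2) amp])
    then show ?thesis unfolding full_RSR_def by blast
  qed

  show "full_nondegenerate_RSR P V X" if ndRSR: "nondegenerate_RSR P V X"
  proof -
    obtain F \<U> where R: "RSR_by P V X F \<U>" and nd: "nondegenerate P V X F"
      using ndRSR by (auto simp: nondegenerate_RSR_def)
    then have F: "?sq n (F n)" and \<U>: "set_pmf (\<U> n) \<subseteq> Pow (V n)" for n
      by (simp_all add: RSR_by_def)
    have "\<exists>c>0. \<forall>n. c < ?eclue n (F n) (\<U> n)" using R by (simp add: RSR_by_def)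
    then obtain c where c: "0 < c" "\<And>n. c < ?eclue n (F n) (\<U> n)" by blast
    from nd obtain \<epsilon> where F1: "\<And>n x. x \<in> space (config_space (V n)) \<Longrightarrow> F n x \<in> {-1, 1}"
      and \<epsilon>: "0 < \<epsilon>" "\<And>n. \<epsilon> \<le> ?var n (F n)"
      unfolding nondegenerate_def by blast
    \<comment> \<open>The average has variance at least \<open>c\<^sup>2 * \<epsilon>\<close>, which
      is 2 v. Thresholding loses \<open>2 * ?e k\<close>, and this is below v once
      \<open>?e k\<close> is below v / 2, so v remains.\<close>
    define v where "v = c\<^sup>2 * \<epsilon> / 2"
    have v: "0 < v" using c \<epsilon> by (simp add: v_def)
    have Fv: "2 * v \<le> c\<^sup>2 * ?var n (F n)" for n
      using \<epsilon>(2)[of n] mult_left_mono[of \<epsilon> "?var n (F n)" "c\<^sup>2"] by (simp add: v_def del: o_apply)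
    let ?err = "\<lambda>k. ?e k * (1 + 2 * ?e k) / v"
    obtain K where K: "0 < K" "\<And>k. K \<le> k \<Longrightarrow> ?e k < v / 2" "\<And>k. K \<le> k \<Longrightarrow> ?err k < 1 / 2"
      by (rule eventually_less_both[OF tendsto_threshold_error(1) _ tendsto_threshold_error(2), of "v / 2" "1 / 2" v])
        (use v in auto)
    let ?Q = "\<lambda>n G. (\<forall>x. G x \<in> {-1, 1}) \<and> v \<le> ?var n G"
    have "\<exists>G. ?sq n G \<and> ?Q n G \<and> 1 - ?err k \<le> ?eclue n G (?\<W> k (\<U> n))" if k: "K \<le> k" for n k
    proof -
      have "0 < k" using K k by simp
      then obtain G where G: "?sq n G" "\<forall>x. G x \<in> {-1, 1}"
        "c\<^sup>2 * ?var n (F n) - 2 * ?e k \<le> ?var n G"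
        "0 < ?var n G \<longrightarrow> 1 - ?e k * (1 + 2 * ?e k) / ?var n G \<le> ?eclue n G (?\<W> k (\<U> n))"
        by (rule real_process.amplify_expected_clue_boolean[OF process F \<U> c _ F1])
      have Gv: "v \<le> ?var n G" using G(3) Fv[of n] K(2)[OF k] by linarith
      \<comment> \<open>Replacing the variance by its lower bound v makes the error depend on k
        alone, uniformly in n.\<close>
      have "?e k * (1 + 2 * ?e k) / ?var n G \<le> ?err k"
        using Gv v by (intro divide_left_mono) auto
      then have "1 - ?err k \<le> ?eclue n G (?\<W> k (\<U> n))"
        using G(4) Gv v by linarith
      with G Gv show ?thesis by blast
    qed
    note amp = this
    obtain G \<W> where "full_RSR_by P V X G \<W>" and G: "\<forall>n. ?Q n (G n)"
      by (rule full_RSR_by_amplification[where Q = ?Q, OF process assms(2) R tendsto_threshold_error(2) K(3) amp])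
    moreover have "nondegenerate P V X G"
      unfolding nondegenerate_def using G v by blast
    ultimately show ?thesis unfolding full_nondegenerate_RSR_def by blast
  qed

  assume action: "\<forall>n. transitive_action (\<Gamma> n) (V n) (\<phi> n) \<and>
    invariant_law (\<Gamma> n) (\<phi> n) (P n) (V n) (X n)"
  have inv_process: "invariant_process (P n) (V n) (X n) (\<Gamma> n) (\<phi> n)" for n
    using action process[of n]
    by (simp add: invariant_process_def invariant_process_axioms_def transitive_action_def)

  show "full_SR \<Gamma> \<phi> P V X" if SR: "SR \<Gamma> \<phi> P V X"
  proof -
    obtain F U where R: "SR_by \<Gamma> \<phi> P V X F U" using SR by (auto simp: SR_def)
    then have F: "?sq n (F n)" "invariant_fun (\<Gamma> n) (\<phi> n) (V n) (F n)" and U: "U n \<subseteq> V n" for n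
      by (auto simp: SR_by_def)
    obtain c where c: "0 < c" "\<forall>\<^sub>F n in sequentially. c < ?clue n (F n) (U n)"
      by (rule SR_by_eventually_clue[OF R])
    let ?err = "\<lambda>k. 1 / (real k * c\<^sup>2)"
    have "\<exists>G W. ?sq n G \<and> invariant_fun (\<Gamma> n) (\<phi> n) (V n) G \<and> W \<subseteq> V n \<and>
      card W \<le> k * card (U n) \<and> True \<and> 1 - ?err k \<le> ?clue n G W"
      if k: "1 \<le> k" and cn: "c < ?clue n (F n) (U n)" for n k
    proof -
      have "0 < k" using k by simp
      then obtain G W where "?sq n G" "invariant_fun (\<Gamma> n) (\<phi> n) (V n) G"
        "W \<subseteq> V n" "card W \<le> k * card (U n)" "1 - ?err k \<le> ?clue n G W"
        by (rule invariant_process.amplify_clue[OF inv_process F U c(1) cn])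
      then show ?thesis by blast
    qed
    note amp = this
    obtain G W where "full_SR_by \<Gamma> \<phi> P V X G W"
      by (rule full_SR_by_amplification[where Q = "\<lambda>_ _. True", OF process R TrueI tendsto_average_error[OF c(1)] c(2) amp])
    then show ?thesis unfolding full_SR_def by blast
  qed

  show "full_nondegenerate_SR \<Gamma> \<phi> P V X" if ndSR: "nondegenerate_SR \<Gamma> \<phi> P V X"
  proof -
    obtain F U where R: "SR_by \<Gamma> \<phi> P V X F U" and nd: "nondegenerate P V X F"
      using ndSR by (auto simp: nondegenerate_SR_def)
    then have F: "?sq n (F n)" "invariant_fun (\<Gamma> n) (\<phi> n) (V n) (F n)" and U: "U n \<subseteq> V n" for n
      by (auto simp: SR_by_def)
    from nd obtain \<epsilon> where F1: "\<And>n x. x \<in> space (config_space (V n)) \<Longrightarrow> F n x \<in> {-1, 1}"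
      and \<epsilon>: "0 < \<epsilon>" "\<And>n. \<epsilon> \<le> ?var n (F n)"
      unfolding nondegenerate_def by blast
    obtain c where c: "0 < c" "\<forall>\<^sub>F n in sequentially. c < ?clue n (F n) (U n)"
      by (rule SR_by_eventually_clue[OF R])
    define v where "v = c\<^sup>2 * \<epsilon> / 2"
    have v: "0 < v" using c \<epsilon> by (simp add: v_def)
    have Fv: "2 * v \<le> c\<^sup>2 * ?var n (F n)" for n
      using \<epsilon>(2)[of n] mult_left_mono[of \<epsilon> "?var n (F n)" "c\<^sup>2"] by (simp add: v_def del: o_apply)
    let ?err = "\<lambda>k. ?e k * (1 + 2 * ?e k) / v"
    obtain K where K: "0 < K" "\<And>k. K \<le> k \<Longrightarrow> ?e k < v / 2"
      by (rule eventually_less_both[OF tendsto_threshold_error(1) _ tendsto_threshold_error(1), of "v / 2" 1])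
        (use v in auto)
    \<comment> \<open>The predicate has to cover the retained functions \<open>F n\<close> as well:
      these are Boolean on the configuration space and have variance at least \<epsilon>, while the
      amplified ones have variance at least v.\<close>
    let ?Q = "\<lambda>n G. (\<forall>x\<in>space (config_space (V n)). G x \<in> {-1, 1}) \<and> min \<epsilon> v \<le> ?var n G"
    have "\<exists>G W. ?sq n G \<and> invariant_fun (\<Gamma> n) (\<phi> n) (V n) G \<and> W \<subseteq> V n \<and>
      card W \<le> k * card (U n) \<and> ?Q n G \<and> 1 - ?err k \<le> ?clue n G W"
      if k: "K \<le> k" and cn: "c < ?clue n (F n) (U n)" for n k
    proof -
      have k0: "0 < k" using K k by simp
      have small: "2 * ?e k < c\<^sup>2 * ?var n (F n)" using Fv[of n] K(2)[OF k] v by linarith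
      obtain G W where G: "?sq n G" "invariant_fun (\<Gamma> n) (\<phi> n) (V n) G" "\<forall>x. G x \<in> {-1, 1}"
        and W: "W \<subseteq> V n" "card W \<le> k * card (U n)"
        and GW: "c\<^sup>2 * ?var n (F n) - 2 * ?e k \<le> ?var n G"
        "1 - ?e k * (1 + 2 * ?e k) / ?var n G \<le> ?clue n G W"
        by (rule invariant_process.amplify_clue_boolean[OF inv_process F U c(1) cn k0 F1 small])
      have Gv: "v \<le> ?var n G" using GW(1) Fv[of n] K(2)[OF k] by linarith
      have "?e k * (1 + 2 * ?e k) / ?var n G \<le> ?err k"
        using Gv v by (intro divide_left_mono) auto
      then have "1 - ?err k \<le> ?clue n G W" using GW(2) by linarith
      moreover have "min \<epsilon> v \<le> ?var n G" using Gv by linarith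
      ultimately show ?thesis using G W by blast
    qed
    note amp = this
    have QF: "?Q n (F n)" for n using F1 \<epsilon>(2)[of n] by (auto simp: min_le_iff_disj)
    obtain G W where "full_SR_by \<Gamma> \<phi> P V X G W" and G: "\<forall>n. ?Q n (G n)"
      by (rule full_SR_by_amplification[where Q = ?Q, OF process R QF tendsto_threshold_error(2) c(2) amp])
    moreover have "nondegenerate P V X G"
      unfolding nondegenerate_def using G v \<epsilon>(1) by (auto intro!: exI[of _ "min \<epsilon> v"])
    ultimately show ?thesis unfolding full_nondegenerate_SR_def by blast
  qed
qed

end
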